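(* Let $\mathcal{N}$ be the class of all cardinals $Nt(X)$ where $X$ ranges over dyadic compacta. Then $\omega\in\mathcal{N}$, $\omega_1\notin\mathcal{N}$, every singular cardinal belongs to $\mathcal{N}$, and $\kappa^+\in\mathcal{N}$ for every cardinal $\kappa$ of uncountable cofinality.
   Context: A dyadic compactum is a Hausdorff continuous image of $2^\kappa$ for some cardinal $\kappa$. Families of open sets are ordered by inclusion. A poset is $\kappa^{\mathrm{op}}$-like if no element is below $\kappa$-many elements. The Noetherian type $Nt(X)$ of a space $X$ is the least $\kappa\geq\omega$ such that $X$ has a $\kappa^{\mathrm{op}}$-like base. *)

theory Defs
  imports "HOL-Analysis.Analysis"
begin

unbundle cardinal_syntax

definition cantor_cube :: "'i set \<Rightarrow> ('i \<Rightarrow> bool) topology" where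
  "cantor_cube I = product_topology (\<lambda>_. discrete_topology (UNIV :: bool set)) I"

definition dyadic_compactum :: "'i itself \<Rightarrow> 'a topology \<Rightarrow> bool" where
  "dyadic_compactum (_ :: 'i itself) X \<longleftrightarrow>
     Hausdorff_space X \<and>
     (\<exists>(I :: 'i set) f. continuous_map (cantor_cube I) X f \<and>
                        f ` topspace (cantor_cube I) = topspace X)"

definition is_base :: "'a topology \<Rightarrow> 'a set set \<Rightarrow> bool" where
  "is_base X B \<longleftrightarrow> openin X = arbitrary union_of (\<lambda>V. V \<in> B)"

definition op_like :: "'a set set \<Rightarrow> 'k rel \<Rightarrow> bool" where
  "op_like B \<kappa> \<longleftrightarrow> (\<forall>U\<in>B. |{V \<in> B. U \<subseteq> V}| <o \<kappa>)"

definition has_op_like_base :: "'a topology \<Rightarrow> 'k rel \<Rightarrow> bool" where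
  "has_op_like_base X \<kappa> \<longleftrightarrow> (\<exists>B. is_base X B \<and> op_like B \<kappa>)"

text \<open>\<open>Nt(X) = \<kappa>\<close>: \<open>\<kappa>\<close> is the least infinite cardinal such that X has a \<open>\<kappa>^op\<close>-like base.
  Every cardinal below \<open>\<kappa>\<close> is the cardinality of a subset of the field of \<open>\<kappa>\<close>.\<close>
definition Nt_eq :: "'a topology \<Rightarrow> 'k rel \<Rightarrow> bool" where
  "Nt_eq X \<kappa> \<longleftrightarrow> Card_order \<kappa> \<and> natLeq \<le>o \<kappa> \<and> has_op_like_base X \<kappa> \<and>
     (\<forall>A \<subseteq> Field \<kappa>. natLeq \<le>o card_of A \<and> card_of A <o \<kappa> \<longrightarrow> \<not> has_op_like_base X (card_of A))"

definition singular_card :: "'k rel \<Rightarrow> bool" where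
  "singular_card \<kappa> \<longleftrightarrow> Card_order \<kappa> \<and> \<not> finite (Field \<kappa>) \<and> \<not> regularCard \<kappa>"

definition uncountable_cofinality :: "'k rel \<Rightarrow> bool" where
  "uncountable_cofinality \<kappa> \<longleftrightarrow> Card_order \<kappa> \<and> \<not> finite (Field \<kappa>) \<and>
     (\<forall>K \<subseteq> Field \<kappa>. cofinal K \<kappa> \<longrightarrow> \<not> countable K)"

end

theory Submission
  imports Defs "HOL-Library.Countable_Set_Type"
begin

text \<open>
  Excluding \<open>\<omega>\<^sub>1\<close>: let \<open>X\<close> be the image of \<open>2^I\<close> and let \<open>B\<close> be a base in which every element has
  countably many supersets. Subfamilies \<open>D \<subseteq> B\<close> closed under suitable finitary operations imitate
  elementary submodels; in particular they are upward closed in \<open>B\<close>, so an element of \<open>B\<close> outside \<open>D\<close>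
  contains no element of \<open>D\<close>. Conversely, projecting clopen sets of the cube to the coordinates of \<open>D\<close>
  shows that all supersets visible from \<open>D\<close> of a given open set contain a common element of \<open>D\<close>.
  Writing \<open>B\<close> as a well-ordered union of smaller closed subfamilies, and recursively each of these
  relative to the union of the earlier ones, one chooses new basic sets below new elements of \<open>B\<close>
  only; the countable steps are as for metrizable spaces. In the resulting base every element has
  finitely many supersets.

  The other values are attained by the wedge of \<open>2^\<kappa>\<close> and \<open>2^\<lambda>\<close> at a point, with \<open>\<lambda> = \<omega>\<close> for \<open>\<kappa>\<^sup>+\<close> and
  \<open>\<lambda> = cf \<kappa>\<close> for singular \<open>\<kappa>\<close>: the common point has \<open>\<pi>\<close>-character \<open>\<lambda>\<close> and character \<open>\<kappa>\<close>, so some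
  open set has many supersets in any base.
\<close>

section \<open>Cantor cubes\<close>

text \<open>The value omega_1 is special because upward closure adds only countably many sets per
  element: any infinite subfamily of B then lies in a closed family of the same size. Members of B
  are themselves unsuitable for the projection argument, since their preimages in the cube may
  depend on uncountably many coordinates; Urysohn functions between members of B replace them, as
  each depends on countably many.

  In a wedge with coordinate sets K and L, an open set on the L side close to the common point can
  ignore the coordinates in K. One such set therefore lies in all basic neighbourhoods of that point
  with the same restricted coordinates in L. All |K| many coordinates must be restricted, but there
  are only |L| many classes of neighbourhoods. For countable L and \<kappa> of uncountable
  cofinality this forces a class of size \<kappa>; for singular \<kappa> and |L| < \<kappa> it only
  excludes a common bound below \<kappa> for the classes, which is why the two values
  differ.\<close>

definition cylinder :: "'i set \<Rightarrow> 'i set \<times> 'i set \<Rightarrow> ('i \<Rightarrow> bool) set" where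
  "cylinder I c = {x \<in> PiE I (\<lambda>_. UNIV). \<forall>i\<in>fst c. x i \<longleftrightarrow> i \<in> snd c}"

lemma topspace_cantor_cube: "topspace (cantor_cube I) = PiE I (\<lambda>_. UNIV)"
  by (simp add: cantor_cube_def)

lemma compact_space_cantor_cube: "compact_space (cantor_cube I)"
  by (simp add: cantor_cube_def compact_space_product_topology compact_space_discrete_topology)

lemma openin_cylinder:
  assumes "finite F" "F \<subseteq> I"
  shows "openin (cantor_cube I) (cylinder I (F, P))"
proof -
  have "cylinder I (F, P) = PiE I (\<lambda>i. if i \<in> F then {i \<in> P} else UNIV)"
    using assms(2) by (simp add: cylinder_def PiE_iff set_eq_iff) blast
  moreover have "openin (cantor_cube I) (PiE I (\<lambda>i. if i \<in> F then {i \<in> P} else UNIV))"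
    unfolding cantor_cube_def openin_PiE_gen
  proof (intro disjI2 conjI ballI)
    show "finite {i \<in> I. (if i \<in> F then {i \<in> P} else UNIV) \<noteq> topspace (discrete_topology (UNIV :: bool set))}"
      by (rule finite_subset[OF _ assms(1)]) auto
  qed auto
  ultimately show ?thesis by simp
qed

lemma cantor_cube_open_nbhd:
  assumes "openin (cantor_cube I) S" "x \<in> S"
  obtains F where "finite F" "F \<subseteq> I" "cylinder I (F, {i \<in> F. x i}) \<subseteq> S"
proof -
  obtain U where U: "finite {i \<in> I. U i \<noteq> topspace (discrete_topology (UNIV :: bool set))}"
      "x \<in> PiE I U" "PiE I U \<subseteq> S"
    using bspec[OF assms(1)[unfolded cantor_cube_def openin_product_topology_alt] assms(2)] by auto
  define F where "F = {i \<in> I. U i \<noteq> UNIV}"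
  have "cylinder I (F, {i \<in> F. x i}) \<subseteq> PiE I U"
  proof
    fix y assume y: "y \<in> cylinder I (F, {i \<in> F. x i})"
    have "y i \<in> U i" if "i \<in> I" for i
    proof (cases "i \<in> F")
      case True
      then have "y i = x i" using y by (auto simp: cylinder_def)
      then show ?thesis using U(2) that by auto
    next
      case False
      then show ?thesis using that by (auto simp: F_def)
    qed
    then show "y \<in> PiE I U" using y by (auto simp: cylinder_def PiE_iff)
  qed
  then show ?thesis using U that[of F] by (auto simp: F_def)
qed

text \<open>The clopen set between \<open>K\<close> and \<open>S\<close> is returned as a finite set
  of codes (restricted coordinates, those with value True), so that it can later be cut down to
  fewer coordinates.\<close>

lemma compactin_subset_open_cylinders:
  assumes K: "compactin (cantor_cube I) K" and S: "openin (cantor_cube I) S" and KS: "K \<subseteq> S"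
  obtains T where "finite T" "T \<subseteq> Fpow I \<times> Fpow I" "K \<subseteq> \<Union>(cylinder I ` T)" "\<Union>(cylinder I ` T) \<subseteq> S"
proof -
  define \<T> where "\<T> = {c \<in> Fpow I \<times> Fpow I. cylinder I c \<subseteq> S}"
  have "\<exists>c\<in>\<T>. x \<in> cylinder I c" if "x \<in> K" for x
  proof -
    have xS: "x \<in> S" using that KS by auto
    from cantor_cube_open_nbhd[OF S this] obtain F where F: "finite F" "F \<subseteq> I"
      "cylinder I (F, {i \<in> F. x i}) \<subseteq> S" .
    have "x \<in> PiE I (\<lambda>_. UNIV)" using openin_subset[OF S] xS by (auto simp: topspace_cantor_cube)
    then have "x \<in> cylinder I (F, {i \<in> F. x i})" by (auto simp: cylinder_def)
    moreover have "(F, {i \<in> F. x i}) \<in> \<T>" using F by (auto simp: \<T>_def Fpow_def)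
    ultimately show ?thesis by blast
  qed
  then have "K \<subseteq> \<Union>(cylinder I ` \<T>)" by auto
  moreover have "\<forall>U\<in>cylinder I ` \<T>. openin (cantor_cube I) U"
    by (auto simp: \<T>_def Fpow_def intro: openin_cylinder)
  ultimately obtain \<F> where \<F>: "finite \<F>" "\<F> \<subseteq> cylinder I ` \<T>" "K \<subseteq> \<Union>\<F>"
    using K unfolding compactin_def by meson
  obtain T where "T \<subseteq> \<T>" "finite T" "\<F> = cylinder I ` T"
    using finite_subset_image[OF \<F>(1,2)] by blast
  then show ?thesis using \<F> that[of T] by (auto simp: \<T>_def)
qed

text \<open>By compactness, for every \<open>e\<close> finitely many cylinders on which
  \<open>h\<close> varies by less than \<open>e\<close> cover the cube, and points agreeing on their
  coordinates share a cylinder. Collecting these finite sets for \<open>e = 1/(n+1)\<close> gives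
  \<open>S\<close>.\<close>

lemma continuous_map_cantor_cube_countable_support:
  assumes h: "continuous_map (cantor_cube I) euclideanreal h"
  shows "\<exists>S. countable S \<and> S \<subseteq> I \<and>
    (\<forall>x\<in>PiE I (\<lambda>_. UNIV). \<forall>y\<in>PiE I (\<lambda>_. UNIV). (\<forall>i\<in>S. x i = y i) \<longrightarrow> h x = h y)"
proof -
  let ?C = "PiE I (\<lambda>_. UNIV :: bool set)"
  have "\<exists>F. finite F \<and> F \<subseteq> I \<and> (\<forall>x\<in>?C. \<forall>y\<in>?C. (\<forall>i\<in>F. x i = y i) \<longrightarrow> \<bar>h x - h y\<bar> < e)"
    if e: "e > 0" for e
  proof -
    define \<T> where "\<T> = {c \<in> Fpow I \<times> Fpow I. \<exists>r. \<forall>y\<in>cylinder I c. \<bar>h y - r\<bar> < e/2}"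
    have "\<exists>c\<in>\<T>. x \<in> cylinder I c" if x: "x \<in> ?C" for x
    proof -
      have op: "openin (cantor_cube I) {y \<in> topspace (cantor_cube I). h y \<in> ball (h x) (e/2)}"
        by (rule openin_continuous_map_preimage[OF h]) auto
      have "x \<in> {y \<in> topspace (cantor_cube I). h y \<in> ball (h x) (e/2)}"
        using x e by (simp add: topspace_cantor_cube)
      from cantor_cube_open_nbhd[OF op this] obtain F where F: "finite F" "F \<subseteq> I"
        "cylinder I (F, {i \<in> F. x i}) \<subseteq> {y \<in> topspace (cantor_cube I). h y \<in> ball (h x) (e/2)}" .
      have "\<forall>y\<in>cylinder I (F, {i \<in> F. x i}). \<bar>h y - h x\<bar> < e/2"
        using F(3) by (auto simp: dist_real_def abs_minus_commute)
      then have "(F, {i \<in> F. x i}) \<in> \<T>" using F(1,2) by (auto simp: \<T>_def Fpow_def)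
      moreover have "x \<in> cylinder I (F, {i \<in> F. x i})" using x by (auto simp: cylinder_def)
      ultimately show ?thesis by blast
    qed
    then have "topspace (cantor_cube I) \<subseteq> \<Union>(cylinder I ` \<T>)" by (auto simp: topspace_cantor_cube)
    moreover have "\<forall>U\<in>cylinder I ` \<T>. openin (cantor_cube I) U"
      by (auto simp: \<T>_def Fpow_def intro: openin_cylinder)
    ultimately obtain \<F> where \<F>: "finite \<F>" "\<F> \<subseteq> cylinder I ` \<T>" "topspace (cantor_cube I) \<subseteq> \<Union>\<F>"
      using compact_space_cantor_cube unfolding compact_space_alt by meson
    obtain T where T: "T \<subseteq> \<T>" "finite T" "\<F> = cylinder I ` T"
      using finite_subset_image[OF \<F>(1,2)] by blast
    define F where "F = \<Union>(fst ` T)"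
    have "finite F" using T by (auto simp: F_def \<T>_def Fpow_def)
    moreover have "F \<subseteq> I" using T(1) unfolding F_def \<T>_def Fpow_def by fastforce
    moreover have "\<bar>h x - h y\<bar> < e" if xy: "x \<in> ?C" "y \<in> ?C" "\<forall>i\<in>F. x i = y i" for x y
    proof -
      have "x \<in> \<Union>\<F>"
        using xy(1) by (intro subsetD[OF \<F>(3)]) (simp add: topspace_cantor_cube)
      then obtain c where c: "c \<in> T" "x \<in> cylinder I c" using T(3) by blast
      have "y \<in> cylinder I c" using c xy by (auto simp: cylinder_def F_def)
      moreover obtain r where "\<forall>y\<in>cylinder I c. \<bar>h y - r\<bar> < e/2" using c T(1) by (auto simp: \<T>_def)
      ultimately have "\<bar>h x - r\<bar> < e/2" "\<bar>h y - r\<bar> < e/2" using c by auto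
      then show ?thesis by linarith
    qed
    ultimately show ?thesis by (intro exI[of _ F]) auto
  qed
  then have "\<forall>n::nat. \<exists>F. finite F \<and> F \<subseteq> I \<and> (\<forall>x\<in>?C. \<forall>y\<in>?C. (\<forall>i\<in>F. x i = y i) \<longrightarrow> \<bar>h x - h y\<bar> < inverse (real (Suc n)))"
    by simp
  then obtain F where F: "\<And>n::nat. finite (F n)" "\<And>n. F n \<subseteq> I"
      "\<And>n x y. x \<in> ?C \<Longrightarrow> y \<in> ?C \<Longrightarrow> (\<forall>i\<in>F n. x i = y i) \<Longrightarrow> \<bar>h x - h y\<bar> < inverse (real (Suc n))"
    by metis
  have eq: "h x = h y" if xy: "x \<in> ?C" "y \<in> ?C" "\<forall>i\<in>(\<Union>n. F n). x i = y i" for x y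
  proof (rule ccontr)
    assume "h x \<noteq> h y"
    then obtain n where "inverse (real (Suc n)) < \<bar>h x - h y\<bar>"
      using reals_Archimedean[of "\<bar>h x - h y\<bar>"] by auto
    moreover have "\<bar>h x - h y\<bar> < inverse (real (Suc n))" using F(3) xy by auto
    ultimately show False by linarith
  qed
  show ?thesis
  proof (intro exI conjI ballI impI)
    show "countable (\<Union>n. F n)" using F(1) by (auto intro: countable_finite)
    show "(\<Union>n. F n) \<subseteq> I" using F(2) by auto
  qed (rule eq)
qed

section \<open>Refining a countable family of open sets\<close>

text \<open>A step never adds a set that contains an earlier one, so each set has only finitely many supersets.\<close>

lemma countable_family_refinement:
  assumes cpt: "compact_space X" and cE: "countable E"
    and op: "\<And>U. U \<in> E \<Longrightarrow> openin X U"
    and Int: "\<And>U V. U \<in> E \<Longrightarrow> V \<in> E \<Longrightarrow> U \<inter> V \<in> E"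
    and reg: "\<And>U p. U \<in> E \<Longrightarrow> p \<in> U \<Longrightarrow> \<exists>V\<in>E. p \<in> V \<and> X closure_of V \<subseteq> U"
    and sep: "\<And>U w p. U \<in> E \<Longrightarrow> w \<in> U \<Longrightarrow> p \<in> topspace X - U \<Longrightarrow> \<exists>V\<in>E. p \<in> V \<and> w \<notin> V"
    and sub: "E' \<subseteq> E" and ne: "{} \<notin> E'"
    and down: "\<And>U V. U \<in> E' \<Longrightarrow> V \<in> E \<Longrightarrow> V \<subseteq> U \<Longrightarrow> V \<noteq> {} \<Longrightarrow> V \<in> E'"
  shows "\<exists>A\<subseteq>E'. (\<forall>U\<in>A. finite {V\<in>A. U \<subseteq> V}) \<and> (\<forall>U\<in>E'. \<forall>p\<in>U. \<exists>V\<in>A. p \<in> V \<and> V \<subseteq> U)"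
proof (cases "E' = {}")
  case True
  then show ?thesis by auto
next
  case False
  \<comment> \<open>A task \<open>(V, U)\<close> asks to cover the compact closure of
    \<open>V\<close> by chosen sets inside \<open>U\<close>; by \<open>reg\<close>, the tasks
    together reach every point of every member of \<open>E'\<close>.\<close>
  define Q where "Q = {(V, U). V \<in> E \<and> U \<in> E' \<and> X closure_of V \<subseteq> U}"
  have "Q \<subseteq> E \<times> E" using sub by (auto simp: Q_def)
  then have cQ: "countable Q" using cE by (meson countable_SIGMA countable_subset)
  obtain U0 p0 where "U0 \<in> E'" "p0 \<in> U0" using False ne by fastforce
  then have neQ: "Q \<noteq> {}" using reg[of U0 p0] sub by (auto simp: Q_def)
  define q where "q = from_nat_into Q"
  have q: "q n \<in> Q" for n using from_nat_into[OF neQ] by (simp add: q_def)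
  have qsurj: "\<exists>n. q n = z" if "z \<in> Q" for z
    using from_nat_into_surj[OF cQ that] by (simp add: q_def)
  have step: "\<exists>G. (finite G \<and> G \<subseteq> E') \<and> F \<subseteq> G \<and> (\<forall>U\<in>G - F. \<forall>W\<in>F. \<not> W \<subseteq> U) \<and>
      (\<forall>p\<in>X closure_of (fst (q n)). \<exists>V\<in>G. p \<in> V \<and> V \<subseteq> snd (q n))"
    if F: "finite F \<and> F \<subseteq> E'" for F n
  proof -
    obtain V U where VU: "q n = (V, U)" "V \<in> E" "U \<in> E'" "X closure_of V \<subseteq> U"
      using q[of n] by (auto simp: Q_def)
    have "\<exists>S\<in>E'. p \<in> S \<and> S \<subseteq> U \<and> (S \<in> F \<or> (\<forall>W\<in>F. \<not> W \<subseteq> S))" if p: "p \<in> X closure_of V" for p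
    proof (cases "\<forall>W\<in>F. \<exists>S\<in>E. p \<in> S \<and> \<not> W \<subseteq> S")
      case True
      \<comment> \<open>Each old set is avoided by some neighbourhood of \<open>p\<close>;
        intersecting these with \<open>U\<close> avoids all of the finite \<open>F\<close>.\<close>
      then obtain s where s: "\<And>W. W \<in> F \<Longrightarrow> s W \<in> E \<and> p \<in> s W \<and> \<not> W \<subseteq> s W" by metis
      have "\<exists>S\<in>E. p \<in> S \<and> S \<subseteq> U \<and> (\<forall>W\<in>F'. \<not> W \<subseteq> S)" if "finite F'" "F' \<subseteq> F" for F'
        using that
      proof (induction F' rule: finite_induct)
        case empty
        then show ?case using VU p sub by auto
      next
        case (insert W F')
        then obtain S where S: "S \<in> E" "p \<in> S" "S \<subseteq> U" "\<forall>W\<in>F'. \<not> W \<subseteq> S" by auto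
        show ?case
        proof (intro bexI conjI ballI)
          show "S \<inter> s W \<in> E" "p \<in> S \<inter> s W" "S \<inter> s W \<subseteq> U"
            using S Int[of S "s W"] s[of W] insert.prems by auto
          show "\<not> W' \<subseteq> S \<inter> s W" if "W' \<in> insert W F'" for W'
            using S(4) s[of W] insert.prems that by auto
        qed
      qed
      from this[of F] F obtain S where S: "S \<in> E" "p \<in> S" "S \<subseteq> U" "\<forall>W\<in>F. \<not> W \<subseteq> S" by auto
      then have "S \<in> E'" using down[OF VU(3)] by auto
      then show ?thesis using S by auto
    next
      case False
      \<comment> \<open>Now the old set \<open>W\<close> lies in every member of \<open>E\<close>
        around \<open>p\<close>; \<open>sep\<close> puts \<open>p\<close> into \<open>W\<close>, so
        \<open>W\<close> can be reused.\<close>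
      then obtain W where W: "W \<in> F" and Wmin: "\<And>S. S \<in> E \<Longrightarrow> p \<in> S \<Longrightarrow> W \<subseteq> S" by blast
      have WE: "W \<in> E'" "W \<in> E" using W F sub by auto
      have pX: "p \<in> topspace X" using p closure_of_subset_topspace[of X V] by auto
      obtain w where w: "w \<in> W" using WE ne by (metis all_not_in_conv)
      have "p \<in> W"
      proof (rule ccontr)
        assume "p \<notin> W"
        then obtain S where "S \<in> E" "p \<in> S" "w \<notin> S" using sep[OF WE(2) w] pX by auto
        then show False using Wmin w by auto
      qed
      moreover have "W \<subseteq> U" using Wmin VU p sub by auto
      ultimately show ?thesis using WE W by auto
    qed
    then obtain s where s: "\<And>p. p \<in> X closure_of V \<Longrightarrow>
        s p \<in> E' \<and> p \<in> s p \<and> s p \<subseteq> U \<and> (s p \<in> F \<or> (\<forall>W\<in>F. \<not> W \<subseteq> s p))" by metis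
    have "compactin X (X closure_of V)"
      by (rule closedin_compact_space[OF cpt closedin_closure_of])
    moreover have "\<forall>S\<in>s ` (X closure_of V). openin X S" using s op sub by blast
    moreover have "X closure_of V \<subseteq> \<Union>(s ` (X closure_of V))" using s by blast
    ultimately obtain \<F> where \<F>: "finite \<F>" "\<F> \<subseteq> s ` (X closure_of V)" "X closure_of V \<subseteq> \<Union>\<F>"
      unfolding compactin_def by meson
    show ?thesis
    proof (intro exI conjI)
      show "finite (F \<union> \<F>)" using F \<F> by auto
      show "F \<union> \<F> \<subseteq> E'" using F \<F>(2) s by auto
      show "F \<subseteq> F \<union> \<F>" by auto
      show "\<forall>U\<in>F \<union> \<F> - F. \<forall>W\<in>F. \<not> W \<subseteq> U" using \<F>(2) s by blast
      show "\<forall>p\<in>X closure_of (fst (q n)). \<exists>V\<in>F \<union> \<F>. p \<in> V \<and> V \<subseteq> snd (q n)"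
      proof
        fix p assume "p \<in> X closure_of (fst (q n))"
        then obtain S where "S \<in> \<F>" "p \<in> S" using \<F>(3) VU by auto
        moreover then have "S \<subseteq> U" using \<F>(2) s by auto
        ultimately show "\<exists>V\<in>F \<union> \<F>. p \<in> V \<and> V \<subseteq> snd (q n)" using VU by auto
      qed
    qed
  qed
  have "\<exists>F. (\<forall>n. (finite (F n) \<and> F n \<subseteq> E') \<and> (F n \<subseteq> F (Suc n) \<and>
      (\<forall>U\<in>F (Suc n) - F n. \<forall>W\<in>F n. \<not> W \<subseteq> U) \<and>
      (\<forall>p\<in>X closure_of (fst (q n)). \<exists>V\<in>F (Suc n). p \<in> V \<and> V \<subseteq> snd (q n))))"
  proof (rule dependent_nat_choice)
    show "\<exists>F. finite F \<and> F \<subseteq> E'" by (intro exI[of _ "{}"]) simp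
  qed (rule step)
  then obtain F where F: "\<forall>n. (finite (F n) \<and> F n \<subseteq> E') \<and> (F n \<subseteq> F (Suc n) \<and>
      (\<forall>U\<in>F (Suc n) - F n. \<forall>W\<in>F n. \<not> W \<subseteq> U) \<and>
      (\<forall>p\<in>X closure_of (fst (q n)). \<exists>V\<in>F (Suc n). p \<in> V \<and> V \<subseteq> snd (q n)))" ..
  have F0: "finite (F n) \<and> F n \<subseteq> E'" for n by (rule conjunct1[OF spec[OF F, of n]])
  have F1: "F n \<subseteq> F (Suc n) \<and> (\<forall>U\<in>F (Suc n) - F n. \<forall>W\<in>F n. \<not> W \<subseteq> U) \<and>
      (\<forall>p\<in>X closure_of (fst (q n)). \<exists>V\<in>F (Suc n). p \<in> V \<and> V \<subseteq> snd (q n))" for n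
    by (rule conjunct2[OF spec[OF F, of n]])
  have mono: "m \<le> n \<Longrightarrow> F m \<subseteq> F n" for m n
    using lift_Suc_mono_le[of F m n] F1 by blast
  \<comment> \<open>At the step where a superset of \<open>W\<close> is new, it would contain
    \<open>W\<close> from the previous stage, which the choice of \<open>F\<close> forbids.\<close>
  have late: "U \<in> F m" if "W \<in> F m" "W \<subseteq> U" "U \<in> F (m + k)" for W U m k
    using that(3)
  proof (induction k)
    case (Suc k)
    have "W \<in> F (m + k)" using that(1) mono[of m "m + k"] by auto
    then show ?case using F1[of "m + k"] Suc that(2) by auto
  qed auto
  have "finite {V \<in> (\<Union>n. F n). U \<subseteq> V}" if U: "U \<in> (\<Union>n. F n)" for U
  proof -
    obtain m where m: "U \<in> F m" using U by auto
    have "{V \<in> (\<Union>n. F n). U \<subseteq> V} \<subseteq> F m"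
    proof safe
      fix V n assume "U \<subseteq> V" "V \<in> F n"
      then have "V \<in> F (m + n)" using mono[of n "m + n"] by auto
      then show "V \<in> F m" using late[OF m \<open>U \<subseteq> V\<close>] by auto
    qed
    then show ?thesis using F0 finite_subset by blast
  qed
  moreover have "\<exists>V\<in>(\<Union>n. F n). p \<in> V \<and> V \<subseteq> U" if U: "U \<in> E'" and p: "p \<in> U" for U p
  proof -
    obtain V where V: "V \<in> E" "p \<in> V" "X closure_of V \<subseteq> U" using reg U p sub by blast
    then have "(V, U) \<in> Q" using U by (simp add: Q_def)
    then obtain n where n: "q n = (V, U)" using qsurj by blast
    have "p \<in> X closure_of V" using V closure_of_subset[OF openin_subset[OF op[OF V(1)]]] by auto
    then obtain W where "W \<in> F (Suc n)" "p \<in> W" "W \<subseteq> U" using F1[of n] n by auto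
    then show ?thesis by blast
  qed
  moreover have "(\<Union>n. F n) \<subseteq> E'" using F0 by auto
  ultimately show ?thesis by (intro exI[of _ "\<Union>n. F n"] conjI ballI)
qed

section \<open>Dyadic compacta with a base whose elements have countably many supersets\<close>

text \<open>The empty set is excluded because every member of B contains it: with it,
  \<open>B_countable\<close> would make B countable.\<close>

locale dyadic_base =
  fixes X :: "'b topology" and I :: "'i set" and f :: "('i \<Rightarrow> bool) \<Rightarrow> 'b" and B :: "'b set set"
  assumes Hausdorff: "Hausdorff_space X"
    and cont: "continuous_map (cantor_cube I) X f"
    and onto: "f ` topspace (cantor_cube I) = topspace X"
    and B_open: "\<And>V. V \<in> B \<Longrightarrow> openin X V"
    and B_nbhd: "\<And>U p. openin X U \<Longrightarrow> p \<in> U \<Longrightarrow> \<exists>V\<in>B. p \<in> V \<and> V \<subseteq> U"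
    and B_ne: "{} \<notin> B"
    and B_countable: "\<And>U. U \<in> B \<Longrightarrow> countable {V \<in> B. U \<subseteq> V}"
begin

lemma compact: "compact_space X"
  using image_compactin[OF _ cont] compact_space_cantor_cube onto
  by (metis compact_space_def)

lemma regular_nbhd:
  assumes "openin X U" "p \<in> U"
  shows "\<exists>V\<in>B. p \<in> V \<and> X closure_of V \<subseteq> U"
proof -
  have "regular_space X" using compact Hausdorff compact_Hausdorff_imp_regular_space by blast
  moreover have "closedin X (topspace X - U)" using assms by blast
  moreover have "p \<in> topspace X - (topspace X - U)" using assms openin_subset by blast
  ultimately obtain W where W: "openin X W" "p \<in> W" "disjnt (topspace X - U) (X closure_of W)"
    unfolding regular_space by meson
  obtain V where V: "V \<in> B" "p \<in> V" "V \<subseteq> W" using B_nbhd W by blast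
  have "X closure_of V \<subseteq> X closure_of W" using V closure_of_mono by blast
  moreover have "X closure_of W \<subseteq> U" using W(3) closure_of_subset_topspace[of X W] by (auto simp: disjnt_iff)
  ultimately show ?thesis using V by blast
qed

lemma B_subset_closure: "V \<in> B \<Longrightarrow> V \<subseteq> X closure_of V"
  by (simp add: B_open closure_of_subset openin_subset)

section \<open>Urysohn functions, visible sets and closed families\<close>

definition pairs :: "'b set set \<Rightarrow> ('b set \<times> 'b set) set" where
  "pairs D = {(V', V). V' \<in> D \<and> V \<in> D \<and> X closure_of V' \<subseteq> V}"

text \<open>One fixed Urysohn function per pair, so that a countable set of pairs yields countably
  many functions and coordinates.\<close>

definition sep_fun :: "'b set \<times> 'b set \<Rightarrow> 'b \<Rightarrow> real" where
  "sep_fun z = (SOME g. continuous_map X euclideanreal g \<and>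
     (\<forall>x\<in>X closure_of fst z. g x = 1) \<and> (\<forall>x\<in>topspace X - snd z. g x = 0))"

lemma sep_fun:
  assumes "z \<in> pairs B"
  shows "continuous_map X euclideanreal (sep_fun z)"
    and "x \<in> X closure_of fst z \<Longrightarrow> sep_fun z x = 1"
    and "x \<in> topspace X - snd z \<Longrightarrow> sep_fun z x = 0"
proof -
  have "normal_space X" using compact Hausdorff compact_Hausdorff_or_regular_imp_normal_space by blast
  moreover have "closedin X (topspace X - snd z)" using assms B_open by (auto simp: pairs_def)
  moreover have "disjnt (topspace X - snd z) (X closure_of fst z)"
    using assms by (auto simp: pairs_def disjnt_iff)
  ultimately obtain g where g: "continuous_map X (top_of_set {0..1::real}) g"
    "g ` (topspace X - snd z) \<subseteq> {0}" "g ` (X closure_of fst z) \<subseteq> {1}"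
    using Urysohn_lemma[of X "topspace X - snd z" "X closure_of fst z" 0 1] by auto
  have "continuous_map X euclideanreal g" using g(1) continuous_map_into_fulltopology by blast
  then have "\<exists>g. continuous_map X euclideanreal g \<and>
     (\<forall>x\<in>X closure_of fst z. g x = 1) \<and> (\<forall>x\<in>topspace X - snd z. g x = 0)"
    using g(2,3) by (intro exI[of _ g]) auto
  from someI_ex[OF this] show "continuous_map X euclideanreal (sep_fun z)"
    "x \<in> X closure_of fst z \<Longrightarrow> sep_fun z x = 1"
    "x \<in> topspace X - snd z \<Longrightarrow> sep_fun z x = 0"
    unfolding sep_fun_def by blast+
qed

definition support :: "'b set \<times> 'b set \<Rightarrow> 'i set" where
  "support z = (SOME S. countable S \<and> S \<subseteq> I \<and>
    (\<forall>x\<in>PiE I (\<lambda>_. UNIV). \<forall>y\<in>PiE I (\<lambda>_. UNIV). (\<forall>i\<in>S. x i = y i) \<longrightarrow> sep_fun z (f x) = sep_fun z (f y)))"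

lemma support:
  assumes "z \<in> pairs B"
  shows "countable (support z)" "support z \<subseteq> I"
    and "x \<in> PiE I (\<lambda>_. UNIV) \<Longrightarrow> y \<in> PiE I (\<lambda>_. UNIV) \<Longrightarrow> (\<And>i. i \<in> support z \<Longrightarrow> x i = y i) \<Longrightarrow>
      sep_fun z (f x) = sep_fun z (f y)"
proof -
  have "continuous_map (cantor_cube I) euclideanreal (sep_fun z \<circ> f)"
    using continuous_map_compose[OF cont sep_fun(1)[OF assms]] .
  note support_ex = continuous_map_cantor_cube_countable_support[OF this, unfolded o_def]
  have *: "countable (support z) \<and> support z \<subseteq> I \<and> (\<forall>x\<in>PiE I (\<lambda>_. UNIV). \<forall>y\<in>PiE I (\<lambda>_. UNIV).
      (\<forall>i\<in>support z. x i = y i) \<longrightarrow> sep_fun z (f x) = sep_fun z (f y))"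
    unfolding support_def by (rule someI_ex[OF support_ex])
  show "countable (support z)" "support z \<subseteq> I" using * by simp_all
  show "x \<in> PiE I (\<lambda>_. UNIV) \<Longrightarrow> y \<in> PiE I (\<lambda>_. UNIV) \<Longrightarrow> (\<And>i. i \<in> support z \<Longrightarrow> x i = y i) \<Longrightarrow>
      sep_fun z (f x) = sep_fun z (f y)"
    by (rule conjunct2[OF conjunct2[OF *], THEN bspec, THEN bspec, THEN mp]) auto
qed

definition coords :: "'b set set \<Rightarrow> 'i set" where
  "coords D = \<Union>(support ` pairs D)"

text \<open>Rational thresholds keep countable families countable. The lower level sets supply
  visible neighbourhoods of points outside a visible set, as \<open>basics_separate\<close> and
  \<open>visible_nbhd\<close> require.\<close>

definition subbasic :: "'b set set \<Rightarrow> 'b set set" where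
  "subbasic D = (\<lambda>(a, z). {x \<in> topspace X. a < sep_fun z x}) ` (\<rat> \<times> pairs D)
     \<union> (\<lambda>(a, z). {x \<in> topspace X. sep_fun z x < a}) ` (\<rat> \<times> pairs D)"

text \<open>A subfamily \<open>D\<close> of the base plays the role of an elementary submodel; the sets in \<open>basics D\<close> are
  those visible from it.\<close>

definition basics :: "'b set set \<Rightarrow> 'b set set" where
  "basics D = (\<lambda>\<U>. topspace X \<inter> \<Inter>\<U>) ` Fpow (subbasic D)"

lemma pairs_mono: "D \<subseteq> D' \<Longrightarrow> pairs D \<subseteq> pairs D'"
  by (auto simp: pairs_def)

lemma coords_mono: "D \<subseteq> D' \<Longrightarrow> coords D \<subseteq> coords D'"
  unfolding coords_def using pairs_mono by blast

lemma subbasic_mono: "D \<subseteq> D' \<Longrightarrow> subbasic D \<subseteq> subbasic D'"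
  unfolding subbasic_def using pairs_mono[of D D'] by blast

lemma basics_mono: "D \<subseteq> D' \<Longrightarrow> basics D \<subseteq> basics D'"
  unfolding basics_def using subbasic_mono[of D D'] Fpow_mono by blast

lemma countable_pairs: "countable D \<Longrightarrow> countable (pairs D)"
  by (rule countable_subset[of _ "D \<times> D"]) (auto simp: pairs_def)

lemma countable_coords: "countable D \<Longrightarrow> D \<subseteq> B \<Longrightarrow> countable (coords D)"
  unfolding coords_def using countable_pairs pairs_mono[of D B] support(1)
  by (intro countable_UN) auto

lemma countable_basics: "countable D \<Longrightarrow> countable (basics D)"
  unfolding basics_def subbasic_def
  by (intro countable_image countable_Fpow countable_Un countable_SIGMA countable_rat countable_pairs)

lemma basics_topspace: "topspace X \<in> basics D"
  unfolding basics_def using empty_in_Fpow by (intro image_eqI[of _ _ "{}"]) auto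

lemma basics_Int: "U \<in> basics D \<Longrightarrow> V \<in> basics D \<Longrightarrow> U \<inter> V \<in> basics D"
proof -
  assume "U \<in> basics D" "V \<in> basics D"
  then obtain \<U> \<V> where "U = topspace X \<inter> \<Inter>\<U>" "V = topspace X \<inter> \<Inter>\<V>" "\<U> \<in> Fpow (subbasic D)" "\<V> \<in> Fpow (subbasic D)"
    unfolding basics_def by blast
  then show ?thesis unfolding basics_def by (intro image_eqI[of _ _ "\<U> \<union> \<V>"]) (auto simp: Fpow_def)
qed

lemma subbasic_subset: "S \<in> subbasic D \<Longrightarrow> S \<subseteq> topspace X"
  unfolding subbasic_def by auto

lemma subbasic_basics: "S \<in> subbasic D \<Longrightarrow> S \<in> basics D"
  unfolding basics_def using subbasic_subset[of S D]
  by (intro image_eqI[of _ _ "{S}"]) (auto simp: Fpow_def)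

lemma basics_gt: "z \<in> pairs D \<Longrightarrow> a \<in> \<rat> \<Longrightarrow> {x \<in> topspace X. a < sep_fun z x} \<in> basics D"
  by (rule subbasic_basics) (auto simp: subbasic_def)

lemma basics_lt: "z \<in> pairs D \<Longrightarrow> a \<in> \<rat> \<Longrightarrow> {x \<in> topspace X. sep_fun z x < a} \<in> basics D"
  by (rule subbasic_basics) (auto simp: subbasic_def)

lemma basics_induct [consumes 1, case_names topspace Int]:
  assumes "U \<in> basics D" and "P (topspace X)"
    and step: "\<And>S U. S \<in> subbasic D \<Longrightarrow> U \<in> basics D \<Longrightarrow> P U \<Longrightarrow> P (S \<inter> U)"
  shows "P U"
proof -
  obtain \<U> where \<U>: "finite \<U>" "\<U> \<subseteq> subbasic D" "U = topspace X \<inter> \<Inter>\<U>"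
    using assms(1) by (auto simp: basics_def Fpow_def)
  have "P (topspace X \<inter> \<Inter>\<U>) \<and> topspace X \<inter> \<Inter>\<U> \<in> basics D" using \<U>(1,2)
  proof (induction \<U> rule: finite_induct)
    case empty
    then show ?case using assms(2) basics_topspace by simp
  next
    case (insert S \<U>)
    have "topspace X \<inter> \<Inter>(insert S \<U>) = S \<inter> (topspace X \<inter> \<Inter>\<U>)" by auto
    then show ?case using insert step[of S "topspace X \<inter> \<Inter>\<U>"]
        basics_Int[OF subbasic_basics[of S D], of "topspace X \<inter> \<Inter>\<U>"] by simp
  qed
  then show ?thesis using \<U> by simp
qed

lemma subbasic_cases:
  assumes "S \<in> subbasic D"
  obtains (gt) a z where "a \<in> \<rat>" "z \<in> pairs D" "S = {x \<in> topspace X. a < sep_fun z x}"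
  | (lt) a z where "a \<in> \<rat>" "z \<in> pairs D" "S = {x \<in> topspace X. sep_fun z x < a}"
  using assms unfolding subbasic_def by blast

lemma sep_fun_open:
  assumes "z \<in> pairs B"
  shows "openin X {x \<in> topspace X. a < sep_fun z x}" "openin X {x \<in> topspace X. sep_fun z x < a}"
    "closedin X {x \<in> topspace X. a \<le> sep_fun z x}" "closedin X {x \<in> topspace X. sep_fun z x \<le> a}"
  using openin_continuous_map_preimage[OF sep_fun(1)[OF assms], of "{a<..}"]
    openin_continuous_map_preimage[OF sep_fun(1)[OF assms], of "{..<a}"]
    closedin_continuous_map_preimage[OF sep_fun(1)[OF assms], of "{a..}"]
    closedin_continuous_map_preimage[OF sep_fun(1)[OF assms], of "{..a}"]
  by (simp_all)

lemma basics_open: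
  assumes "U \<in> basics D" "D \<subseteq> B"
  shows "openin X U"
  using assms(1)
proof (induction rule: basics_induct)
  case (Int S U)
  have "openin X S" using Int(1) pairs_mono[OF assms(2)] sep_fun_open(1,2) by (cases rule: subbasic_cases) blast+
  then show ?case using Int by auto
qed auto

text \<open>A threshold moves to a rational strictly between it and the value at \<open>p\<close>;
  the weak inequality then defines a closed set in between.\<close>

lemma basics_regular:
  assumes "U \<in> basics D" "D \<subseteq> B" "p \<in> U"
  shows "\<exists>V\<in>basics D. p \<in> V \<and> X closure_of V \<subseteq> U"
  using assms(1,3)
proof (induction rule: basics_induct)
  case topspace
  then show ?case using basics_topspace by (intro bexI[of _ "topspace X"]) auto
next
  case (Int S U)
  obtain V where V: "V \<in> basics D" "p \<in> V" "X closure_of V \<subseteq> U" using Int by auto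
  have "p \<in> S" using Int by auto
  have "\<exists>W\<in>basics D. p \<in> W \<and> X closure_of W \<subseteq> S"
    using Int(1)
  proof (cases rule: subbasic_cases)
    case (gt a z)
    then have zB: "z \<in> pairs B" using pairs_mono[OF assms(2)] by auto
    obtain b where b: "b \<in> \<rat>" "a < b" "b < sep_fun z p"
      using gt \<open>p \<in> S\<close> Rats_dense_in_real[of a "sep_fun z p"] by auto
    have "X closure_of {x \<in> topspace X. b < sep_fun z x} \<subseteq> {x \<in> topspace X. b \<le> sep_fun z x}"
      by (rule closure_of_minimal) (auto simp: sep_fun_open[OF zB])
    then show ?thesis using gt b \<open>p \<in> S\<close> basics_gt[OF gt(2) b(1)]
      by (intro bexI[of _ "{x \<in> topspace X. b < sep_fun z x}"]) auto
  next
    case (lt a z)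
    then have zB: "z \<in> pairs B" using pairs_mono[OF assms(2)] by auto
    obtain b where b: "b \<in> \<rat>" "b < a" "sep_fun z p < b"
      using lt \<open>p \<in> S\<close> Rats_dense_in_real[of "sep_fun z p" a] by auto
    have "X closure_of {x \<in> topspace X. sep_fun z x < b} \<subseteq> {x \<in> topspace X. sep_fun z x \<le> b}"
      by (rule closure_of_minimal) (auto simp: sep_fun_open[OF zB])
    then show ?thesis using lt b \<open>p \<in> S\<close> basics_lt[OF lt(2) b(1)]
      by (intro bexI[of _ "{x \<in> topspace X. sep_fun z x < b}"]) auto
  qed
  then obtain W where W: "W \<in> basics D" "p \<in> W" "X closure_of W \<subseteq> S" by blast
  have "X closure_of (W \<inter> V) \<subseteq> S \<inter> U"
    using W V closure_of_mono[of "W \<inter> V" W X] closure_of_mono[of "W \<inter> V" V X] by blast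
  then show ?case using basics_Int W V by (intro bexI[of _ "W \<inter> V"]) auto
qed

lemma basics_separate:
  assumes "U \<in> basics D" "w \<in> U" "p \<in> topspace X - U"
  shows "\<exists>V\<in>basics D. p \<in> V \<and> w \<notin> V"
  using assms
proof (induction rule: basics_induct)
  case (Int S U)
  show ?case
  proof (cases "p \<in> S")
    case True
    then show ?thesis using Int by auto
  next
    case False
    show ?thesis
      using Int(1)
    proof (cases rule: subbasic_cases)
      case (gt a z)
      then obtain b where b: "b \<in> \<rat>" "a < b" "b < sep_fun z w"
        using Int Rats_dense_in_real[of a "sep_fun z w"] by auto
      then show ?thesis using gt False Int.prems basics_lt[OF gt(2) b(1)]
        by (intro bexI[of _ "{x \<in> topspace X. sep_fun z x < b}"]) auto
    next
      case (lt a z)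
      then obtain b where b: "b \<in> \<rat>" "sep_fun z w < b" "b < a"
        using Int Rats_dense_in_real[of "sep_fun z w" a] by auto
      then show ?thesis using lt False Int.prems basics_gt[OF lt(2) b(1)]
        by (intro bexI[of _ "{x \<in> topspace X. b < sep_fun z x}"]) auto
    qed
  qed
qed auto

lemma basics_determined:
  assumes "U \<in> basics D" "D \<subseteq> B" "x \<in> PiE I (\<lambda>_. UNIV)" "y \<in> PiE I (\<lambda>_. UNIV)"
    and eq: "\<And>i. i \<in> coords D \<Longrightarrow> x i = y i" and "f x \<in> U"
  shows "f y \<in> U"
  using assms(1) \<open>f x \<in> U\<close>
proof (induction rule: basics_induct)
  case topspace
  then show ?case using assms(4) onto by (auto simp: topspace_cantor_cube)
next
  case (Int S U)
  have "f y \<in> topspace X" using assms(4) onto by (auto simp: topspace_cantor_cube)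
  moreover have "sep_fun z (f y) = sep_fun z (f x)" if "z \<in> pairs D" for z
  proof (rule support(3)[OF _ assms(4,3)])
    show "z \<in> pairs B" using that pairs_mono[OF assms(2)] by auto
    show "y i = x i" if "i \<in> support z" for i
      using eq[of i, symmetric] \<open>z \<in> pairs D\<close> that unfolding coords_def by blast
  qed
  moreover have "f x \<in> S" using Int.prems by blast
  ultimately have "f y \<in> S"
    using Int.hyps(1) by (elim subbasic_cases) auto
  then show ?case using Int by auto
qed

text \<open>First of the finite character results: each visible object involves finitely many
  members of \<open>D\<close>, so the closure conditions are finitary and pass to unions of
  chains.\<close>

lemma finite_subset_pairs:
  assumes "z \<in> pairs D"
  shows "\<exists>F. finite F \<and> F \<subseteq> D \<and> z \<in> pairs F"
  using assms by (intro exI[of _ "{fst z, snd z}"]) (auto simp: pairs_def)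

lemma finite_subset_basics:
  assumes "U \<in> basics D"
  shows "\<exists>F. finite F \<and> F \<subseteq> D \<and> U \<in> basics F"
  using assms
proof (induction rule: basics_induct)
  case topspace
  then show ?case using basics_topspace by blast
next
  case (Int S U)
  have "\<exists>F. finite F \<and> F \<subseteq> D \<and> S \<in> basics F"
    using Int(1)
  proof (cases rule: subbasic_cases)
    case (gt a z)
    then show ?thesis using finite_subset_pairs[of z D] basics_gt by metis
  next
    case (lt a z)
    then show ?thesis using finite_subset_pairs[of z D] basics_lt by metis
  qed
  then obtain F where F: "finite F" "F \<subseteq> D" "S \<in> basics F" by blast
  obtain F' where F': "finite F'" "F' \<subseteq> D" "U \<in> basics F'" using Int by blast
  have "S \<inter> U \<in> basics (F \<union> F')"
    using F F' basics_mono[of F "F \<union> F'"] basics_mono[of F' "F \<union> F'"] by (intro basics_Int) auto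
  then show ?case using F F' by (intro exI[of _ "F \<union> F'"]) auto
qed

lemma finite_subset_coords:
  assumes "finite P" "P \<subseteq> coords D"
  shows "\<exists>F. finite F \<and> F \<subseteq> D \<and> P \<subseteq> coords F"
  using assms
proof (induction P rule: finite_induct)
  case empty
  then show ?case by blast
next
  case (insert i P)
  then obtain z where z: "z \<in> pairs D" "i \<in> support z" by (auto simp: coords_def)
  obtain F where F: "finite F" "F \<subseteq> D" "z \<in> pairs F" using finite_subset_pairs[OF z(1)] by blast
  obtain F' where F': "finite F'" "F' \<subseteq> D" "P \<subseteq> coords F'" using insert by auto
  have "i \<in> coords F" using F z by (auto simp: coords_def)
  then have "insert i P \<subseteq> coords (F \<union> F')"
    using F' coords_mono[of F "F \<union> F'"] coords_mono[of F' "F \<union> F'"] by auto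
  then show ?case using F F' by (intro exI[of _ "F \<union> F'"]) auto
qed

lemma finite_subset_cylinders:
  assumes "finite T" "T \<subseteq> Fpow (coords D) \<times> Fpow (coords D)"
  shows "\<exists>F. finite F \<and> F \<subseteq> D \<and> T \<subseteq> Fpow (coords F) \<times> Fpow (coords F)"
proof -
  define P where "P = \<Union>(fst ` T) \<union> \<Union>(snd ` T)"
  have fin: "finite (fst t)" "finite (snd t)" "fst t \<subseteq> coords D" "snd t \<subseteq> coords D" if "t \<in> T" for t
    using subsetD[OF assms(2) that] by (simp_all add: Fpow_def mem_Times_iff)
  have "finite P" "P \<subseteq> coords D" using assms(1) fin by (simp_all add: P_def UN_least)
  then obtain F where F: "finite F" "F \<subseteq> D" "P \<subseteq> coords F" using finite_subset_coords by metis
  have "T \<subseteq> Fpow (coords F) \<times> Fpow (coords F)"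
  proof
    fix t assume t: "t \<in> T"
    have "fst t \<subseteq> coords F" "snd t \<subseteq> coords F" using t F(3) by (auto simp: P_def)
    then show "t \<in> Fpow (coords F) \<times> Fpow (coords F)"
      using fin[OF t] by (simp add: Fpow_def mem_Times_iff)
  qed
  then show ?thesis using F by blast
qed

text \<open>Members of \<open>D\<close> need not belong to \<open>basics D\<close>; the level 1/2,
  between the values 1 and 0, interpolates a visible open set between the two members of a
  pair.\<close>

lemma sep_nbhd:
  assumes "z \<in> pairs D" "D \<subseteq> B"
  shows "{x \<in> topspace X. 1/2 < sep_fun z x} \<in> basics D"
    and "fst z \<subseteq> {x \<in> topspace X. 1/2 < sep_fun z x}"
    and "{x \<in> topspace X. 1/2 < sep_fun z x} \<subseteq> snd z"
proof -
  have zB: "z \<in> pairs B" using assms pairs_mono by blast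
  show "{x \<in> topspace X. 1/2 < sep_fun z x} \<in> basics D" 
    by (intro basics_gt[OF assms(1)] Rats_divide) simp_all
  have "fst z \<in> B" using zB by (auto simp: pairs_def)
  then show "fst z \<subseteq> {x \<in> topspace X. 1/2 < sep_fun z x}"
    using sep_fun(2)[OF zB] B_subset_closure[of "fst z"] closure_of_subset_topspace[of X "fst z"] by force
  show "{x \<in> topspace X. 1/2 < sep_fun z x} \<subseteq> snd z"
    using sep_fun(3)[OF zB] by force
qed

text \<open>The last condition reflects nonempty interior: the open witness \<open>W\<close> is
  arbitrary, but the clopen set is coded by coordinates of \<open>D\<close>, and then
  \<open>D\<close> itself must have a member inside the image.\<close>

definition closed_family :: "'b set set \<Rightarrow> bool" where
  "closed_family D \<longleftrightarrow> D \<subseteq> B \<and>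
     (\<forall>U\<in>D. \<forall>V\<in>B. U \<subseteq> V \<longrightarrow> V \<in> D) \<and>
     (\<forall>V\<in>D. \<exists>V'\<in>D. X closure_of V' \<subseteq> V) \<and>
     (\<forall>T W. finite T \<longrightarrow> T \<subseteq> Fpow (coords D) \<times> Fpow (coords D) \<longrightarrow>
        openin X W \<longrightarrow> W \<noteq> {} \<longrightarrow> W \<subseteq> f ` \<Union>(cylinder I ` T) \<longrightarrow>
        (\<exists>V\<in>D. V \<subseteq> f ` \<Union>(cylinder I ` T)))"

lemma closed_familyD:
  assumes "closed_family D"
  shows "D \<subseteq> B" "\<And>U V. U \<in> D \<Longrightarrow> V \<in> B \<Longrightarrow> U \<subseteq> V \<Longrightarrow> V \<in> D"
    "\<And>V. V \<in> D \<Longrightarrow> \<exists>V'\<in>D. X closure_of V' \<subseteq> V"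
    "\<And>T W. finite T \<Longrightarrow> T \<subseteq> Fpow (coords D) \<times> Fpow (coords D) \<Longrightarrow> openin X W \<Longrightarrow> W \<noteq> {} \<Longrightarrow>
      W \<subseteq> f ` \<Union>(cylinder I ` T) \<Longrightarrow> \<exists>V\<in>D. V \<subseteq> f ` \<Union>(cylinder I ` T)"
  using assms unfolding closed_family_def by simp_all

text \<open>The only use of dyadicity: enlarging a clopen subset of the cube to its cylinder over
  \<open>coords D\<close> does not leave the preimage of an open set visible from \<open>D\<close>.\<close>

lemma projection:
  assumes D: "closed_family D" and W: "openin X W" "W \<noteq> {}"
  shows "\<exists>V\<in>D. \<forall>U\<in>basics D. W \<subseteq> U \<longrightarrow> V \<subseteq> U"
proof -
  let ?C = "PiE I (\<lambda>_. UNIV :: bool set)"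
  have DB: "D \<subseteq> B" using D by (rule closed_familyD)
  obtain p where "p \<in> W" using W by blast
  \<comment> \<open>Shrinking \<open>W\<close> to \<open>V0\<close> leaves room for a clopen set
    between the preimages of the closure of \<open>V0\<close> and of \<open>W\<close>.\<close>
  then obtain V0 where V0: "V0 \<in> B" "p \<in> V0" "X closure_of V0 \<subseteq> W" using regular_nbhd W by blast
  have "closedin (cantor_cube I) {x \<in> topspace (cantor_cube I). f x \<in> X closure_of V0}"
    by (rule closedin_continuous_map_preimage[OF cont]) auto
  then have "compactin (cantor_cube I) {x \<in> topspace (cantor_cube I). f x \<in> X closure_of V0}"
    using compact_space_cantor_cube closedin_compact_space by blast
  moreover have "openin (cantor_cube I) {x \<in> topspace (cantor_cube I). f x \<in> W}"
    by (rule openin_continuous_map_preimage[OF cont W(1)])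
  moreover have "{x \<in> topspace (cantor_cube I). f x \<in> X closure_of V0} \<subseteq> {x \<in> topspace (cantor_cube I). f x \<in> W}"
    using V0 by auto
  ultimately obtain T where T: "finite T" "T \<subseteq> Fpow I \<times> Fpow I"
    "{x \<in> topspace (cantor_cube I). f x \<in> X closure_of V0} \<subseteq> \<Union>(cylinder I ` T)"
    "\<Union>(cylinder I ` T) \<subseteq> {x \<in> topspace (cantor_cube I). f x \<in> W}"
    by (rule compactin_subset_open_cylinders)
  \<comment> \<open>Forgetting all restrictions outside \<open>coords D\<close> enlarges the clopen
    set, so its image still contains \<open>V0\<close>, and the codes now use coordinates of
    \<open>D\<close> only.\<close>
  define T' where "T' = (\<lambda>(F, P). (F \<inter> coords D, P \<inter> coords D)) ` T"
  have T': "finite T'" "T' \<subseteq> Fpow (coords D) \<times> Fpow (coords D)"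
    using T(1,2) by (auto simp: T'_def Fpow_def)
  have TT': "\<Union>(cylinder I ` T) \<subseteq> \<Union>(cylinder I ` T')"
    by (force simp: T'_def cylinder_def)
  have "V0 \<subseteq> f ` \<Union>(cylinder I ` T)"
  proof
    fix y assume y: "y \<in> V0"
    then have "y \<in> X closure_of V0" using V0 B_subset_closure by blast
    moreover have "y \<in> topspace X" using y V0(1) B_open openin_subset by blast
    ultimately obtain x where "x \<in> {x \<in> topspace (cantor_cube I). f x \<in> X closure_of V0}" "y = f x"
      using onto by (metis (mono_tags, lifting) imageE mem_Collect_eq)
    then show "y \<in> f ` \<Union>(cylinder I ` T)" using T(3) by blast
  qed
  then have "V0 \<subseteq> f ` \<Union>(cylinder I ` T')" using TT' by (meson image_mono order_trans)
  then obtain V where V: "V \<in> D" "V \<subseteq> f ` \<Union>(cylinder I ` T')"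
    using closed_familyD(4)[OF D T', of V0] V0 B_open by blast
  have "V \<subseteq> U" if U: "U \<in> basics D" "W \<subseteq> U" for U
  proof
    fix v assume "v \<in> V"
    then obtain F P x where x: "(F, P) \<in> T" "x \<in> cylinder I (F \<inter> coords D, P \<inter> coords D)" "v = f x"
      using V(2) by (auto simp: T'_def)
    \<comment> \<open>Restoring the forgotten restrictions moves \<open>x\<close> into the original
      clopen set without changing a coordinate in \<open>coords D\<close>, so no set visible from
      \<open>D\<close> notices.\<close>
    define y where "y = (\<lambda>i. if i \<in> F then i \<in> P else x i)"
    have F: "F \<subseteq> I" using x(1) T(2) by (auto simp: Fpow_def)
    have xC: "x \<in> ?C" using x(2) by (simp add: cylinder_def)
    then have yC: "y \<in> ?C" using F by (auto simp: y_def PiE_iff extensional_def)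
    then have "y \<in> cylinder I (F, P)" by (simp add: cylinder_def y_def)
    then have "f y \<in> W" using T(4) x(1) by blast
    moreover have "y i = x i" if "i \<in> coords D" for i
      using that x(2) by (auto simp: y_def cylinder_def)
    ultimately show "v \<in> U" using basics_determined[OF U(1) DB yC xC] U(2) x(3) by blast
  qed
  then show ?thesis using V by blast
qed

end

section \<open>Skolem hulls and refinement over a countable subfamily\<close>

lemma countable_closure:
  assumes \<Phi>: "\<And>F. finite F \<Longrightarrow> F \<subseteq> S \<Longrightarrow> countable (\<Phi> F) \<and> \<Phi> F \<subseteq> S"
    and Y: "countable Y" "Y \<subseteq> S"
  shows "\<exists>Z. Y \<subseteq> Z \<and> Z \<subseteq> S \<and> countable Z \<and> (\<forall>F. finite F \<longrightarrow> F \<subseteq> Z \<longrightarrow> \<Phi> F \<subseteq> Z)"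
proof -
  \<comment> \<open>Omega rounds suffice: a finite subset of the union already lies in one
    round.\<close>
  define Z where "Z = rec_nat Y (\<lambda>_ W. W \<union> \<Union>(\<Phi> ` Fpow W))"
  have Z0: "Z 0 = Y" and ZS: "Z (Suc n) = Z n \<union> \<Union>(\<Phi> ` Fpow (Z n))" for n
    by (simp_all add: Z_def)
  have Z: "countable (Z n) \<and> Z n \<subseteq> S" for n
  proof (induction n)
    case 0
    then show ?case using Y by (simp add: Z0)
  next
    case (Suc n)
    then have "countable (\<Phi> F) \<and> \<Phi> F \<subseteq> S" if "F \<in> Fpow (Z n)" for F
      using that \<Phi>[of F] by (auto simp: Fpow_def)
    then show ?case using Suc by (simp add: ZS countable_Fpow UN_least)
  qed
  have mono: "m \<le> n \<Longrightarrow> Z m \<subseteq> Z n" for m n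
    by (rule lift_Suc_mono_le[of Z]) (auto simp: ZS)
  have "\<Phi> F \<subseteq> (\<Union>n. Z n)" if F: "finite F" "F \<subseteq> (\<Union>n. Z n)" for F
  proof -
    have "\<exists>n. F \<subseteq> Z n" using F
    proof (induction F rule: finite_induct)
      case (insert x F)
      then obtain m n where "F \<subseteq> Z m" "x \<in> Z n" by auto
      then have "insert x F \<subseteq> Z (max m n)"
        using mono[of m "max m n"] mono[of n "max m n"] by auto
      then show ?case by blast
    qed auto
    then obtain n where "F \<subseteq> Z n" by blast
    then have "\<Phi> F \<subseteq> Z (Suc n)" using F(1) by (auto simp: ZS Fpow_def)
    then show ?thesis by blast
  qed
  moreover have "Y \<subseteq> (\<Union>n. Z n)" using Z0 by blast
  moreover have "(\<Union>n. Z n) \<subseteq> S" "countable (\<Union>n. Z n)" using Z by auto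
  ultimately show ?thesis by (intro exI[of _ "\<Union>n. Z n"]) simp
qed

context dyadic_base
begin

text \<open>\<open>C\<close> holds the members of B left to earlier stages: chosen sets lie below a
  member outside \<open>C\<close>, and nothing is demanded around points whose neighbourhoods in B
  all lie in \<open>C\<close>.\<close>

definition refined :: "'b set set \<Rightarrow> 'b set set \<Rightarrow> 'b set set \<Rightarrow> bool" where
  "refined D C A \<longleftrightarrow> closed_family D \<and> A \<subseteq> basics D \<and>
     (\<forall>U\<in>A. U \<noteq> {} \<and> (\<exists>V\<in>B - C. U \<subseteq> V)) \<and>
     (\<forall>U\<in>A. finite {V \<in> A. U \<subseteq> V}) \<and>
     (\<forall>U\<in>basics D. U \<subseteq> \<Union>(B - C) \<longrightarrow> (\<forall>p\<in>U. \<exists>V\<in>A. p \<in> V \<and> V \<subseteq> U))"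

lemma refinedD:
  assumes "refined D C A"
  shows "closed_family D" "A \<subseteq> basics D"
    "\<And>U. U \<in> A \<Longrightarrow> U \<noteq> {}" "\<And>U. U \<in> A \<Longrightarrow> \<exists>V\<in>B - C. U \<subseteq> V"
    "\<And>U. U \<in> A \<Longrightarrow> finite {V \<in> A. U \<subseteq> V}"
    "\<And>U p. U \<in> basics D \<Longrightarrow> U \<subseteq> \<Union>(B - C) \<Longrightarrow> p \<in> U \<Longrightarrow> \<exists>V\<in>A. p \<in> V \<and> V \<subseteq> U"
  using assms unfolding refined_def by simp_all

text \<open>Carries finiteness from \<open>A\<close> over to \<open>D - C\<close>: whatever contains
  \<open>V\<close> contains some \<open>U\<close> in \<open>A\<close>, which has finitely many
  supersets in \<open>A\<close>.\<close>

lemma refined_below: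
  assumes "refined D C A" "V \<in> D" "V \<notin> C"
  shows "\<exists>U\<in>A. U \<subseteq> V"
proof -
  have D: "closed_family D" using assms by (simp add: refined_def)
  note DB = closed_familyD(1)[OF D]
  obtain V' where V': "V' \<in> D" "X closure_of V' \<subseteq> V" using closed_familyD(3)[OF D assms(2)] by blast
  then have z: "(V', V) \<in> pairs D" using assms(2) by (simp add: pairs_def)
  note W = sep_nbhd[OF z DB]
  have "V \<in> B - C" using assms DB by auto
  then have "V \<subseteq> \<Union>(B - C)" by blast
  moreover obtain p where "p \<in> V'" using V' DB B_ne by (metis all_not_in_conv subsetD)
  ultimately have "\<exists>U\<in>A. p \<in> U \<and> U \<subseteq> {x \<in> topspace X. 1/2 < sep_fun (V', V) x}"
    using W(2,3) by (intro refinedD(6)[OF assms(1) W(1)]) auto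
  then show ?thesis using W by auto
qed

text \<open>Besides the functions for \<open>closed_family\<close>, the Skolem hull uses
  \<open>\<psi>\<close>, which supplies finitely many pairs around the closure of a visible set when
  that closure is covered by \<open>B - C\<close>. Each point then has a visible neighbourhood below
  a single member of \<open>B - C\<close>.\<close>

lemma refined_countable:
  assumes Y: "countable Y" "Y \<subseteq> B"
  shows "\<exists>D A. Y \<subseteq> D \<and> countable D \<and> refined D C A"
proof -
  have "\<exists>W\<in>B. X closure_of W \<subseteq> V" if V: "V \<in> B" for V
  proof -
    obtain p where "p \<in> V" using V B_ne by (metis all_not_in_conv)
    then show ?thesis using regular_nbhd B_open V by blast
  qed
  then obtain s where s: "\<And>V. V \<in> B \<Longrightarrow> s V \<in> B \<and> X closure_of s V \<subseteq> V" by metis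
  have "\<exists>V. W \<noteq> {} \<longrightarrow> openin X W \<longrightarrow> V \<in> B \<and> V \<subseteq> W" for W
  proof (cases "W = {}")
    case False
    then obtain p where "p \<in> W" by blast
    then show ?thesis using B_nbhd[of W p] by metis
  qed simp
  then have "\<exists>t. \<forall>W. W \<noteq> {} \<longrightarrow> openin X W \<longrightarrow> t W \<in> B \<and> t W \<subseteq> W" by (intro choice allI)
  then obtain t where t: "\<And>W. W \<noteq> {} \<Longrightarrow> openin X W \<Longrightarrow> t W \<in> B \<and> t W \<subseteq> W" by auto
  define c where "c T = t (X interior_of (f ` \<Union>(cylinder I ` T)))" for T
  have c: "c T \<in> B \<and> c T \<subseteq> f ` \<Union>(cylinder I ` T)" if "X interior_of (f ` \<Union>(cylinder I ` T)) \<noteq> {}" for T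
    using t[OF that] interior_of_subset[of X "f ` \<Union>(cylinder I ` T)"] by (auto simp: c_def)
  have "\<exists>\<V>. finite \<V> \<and> \<V> \<subseteq> B \<and>
      (\<forall>p\<in>X closure_of U. \<exists>V'\<in>\<V>. \<exists>V\<in>\<V> - C. p \<in> V' \<and> X closure_of V' \<subseteq> V)"
    if U: "X closure_of U \<subseteq> \<Union>(B - C)" for U
  proof -
    have "\<exists>V' V. V' \<in> B \<and> V \<in> B - C \<and> p \<in> V' \<and> X closure_of V' \<subseteq> V" if p: "p \<in> X closure_of U" for p
    proof -
      obtain V where V: "V \<in> B - C" "p \<in> V" using subsetD[OF U p] by blast
      then show ?thesis using regular_nbhd[of V p] B_open by blast
    qed
    then have "\<forall>p\<in>X closure_of U. \<exists>z. fst z \<in> B \<and> snd z \<in> B - C \<and> p \<in> fst z \<and> X closure_of fst z \<subseteq> snd z"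
      by simp
    from bchoice[OF this] obtain w where w: "\<forall>p\<in>X closure_of U.
        fst (w p) \<in> B \<and> snd (w p) \<in> B - C \<and> p \<in> fst (w p) \<and> X closure_of fst (w p) \<subseteq> snd (w p)" ..
    define v' v where "v' p = fst (w p)" and "v p = snd (w p)" for p
    have v: "v' p \<in> B \<and> v p \<in> B - C \<and> p \<in> v' p \<and> X closure_of v' p \<subseteq> v p" if "p \<in> X closure_of U" for p
      unfolding v'_def v_def by (rule bspec[OF w that])
    have "compactin X (X closure_of U)"
      by (rule closedin_compact_space[OF compact closedin_closure_of])
    moreover have "\<forall>V\<in>v' ` (X closure_of U). openin X V"
      using v B_open by (intro ballI) (elim imageE, simp)
    moreover have "X closure_of U \<subseteq> \<Union>(v' ` (X closure_of U))"
    proof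
      fix p assume "p \<in> X closure_of U"
      then show "p \<in> \<Union>(v' ` (X closure_of U))" using v[of p] by blast
    qed
    ultimately obtain \<F> where \<F>: "finite \<F>" "\<F> \<subseteq> v' ` (X closure_of U)" "X closure_of U \<subseteq> \<Union>\<F>"
      unfolding compactin_def by meson
    obtain Q where Q: "Q \<subseteq> X closure_of U" "finite Q" "\<F> = v' ` Q"
      using finite_subset_image[OF \<F>(1,2)] by blast
    have "\<exists>V'\<in>v' ` Q \<union> v ` Q. \<exists>V\<in>(v' ` Q \<union> v ` Q) - C. p \<in> V' \<and> X closure_of V' \<subseteq> V"
      if p: "p \<in> X closure_of U" for p
    proof -
      have "p \<in> \<Union>(v' ` Q)" using p \<F>(3) Q(3) by auto
      then obtain q where q: "q \<in> Q" "p \<in> v' q" by blast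
      then show ?thesis using v[of q] Q(1) by (intro bexI[of _ "v' q"] bexI[of _ "v q"]) auto
    qed
    moreover have "finite (v' ` Q \<union> v ` Q)" using Q by simp
    moreover have "v' ` Q \<union> v ` Q \<subseteq> B" using v Q(1) by blast
    ultimately show ?thesis by (intro exI[of _ "v' ` Q \<union> v ` Q"]) simp
  qed
  then obtain \<psi> where \<psi>: "\<And>U. X closure_of U \<subseteq> \<Union>(B - C) \<Longrightarrow> finite (\<psi> U) \<and> \<psi> U \<subseteq> B \<and>
      (\<forall>p\<in>X closure_of U. \<exists>V'\<in>\<psi> U. \<exists>V\<in>\<psi> U - C. p \<in> V' \<and> X closure_of V' \<subseteq> V)"
    by metis
  define \<T> where "\<T> F = {T \<in> Fpow (Fpow (coords F) \<times> Fpow (coords F)).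
      X interior_of (f ` \<Union>(cylinder I ` T)) \<noteq> {}}" for F
  \<comment> \<open>The four parts provide upward closure, shrinking, reflection of interiors and
    local witnesses outside \<open>C\<close>; the first is countable by
    \<open>B_countable\<close>.\<close>
  define \<Phi> where "\<Phi> F = (\<Union>U\<in>F. {V \<in> B. U \<subseteq> V}) \<union> s ` F \<union> c ` \<T> F
     \<union> (\<Union>U\<in>{U \<in> basics F. X closure_of U \<subseteq> \<Union>(B - C)}. \<psi> U)" for F
  have \<Phi>: "countable (\<Phi> F) \<and> \<Phi> F \<subseteq> B" if F: "finite F" "F \<subseteq> B" for F
  proof
    have "countable (Fpow (Fpow (coords F) \<times> Fpow (coords F)))"
      using countable_coords[of F] F by (intro countable_Fpow countable_SIGMA) (auto simp: countable_finite)
    then have "countable (\<T> F)" unfolding \<T>_def by (rule countable_subset[rotated]) blast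
    moreover have "countable {U \<in> basics F. X closure_of U \<subseteq> \<Union>(B - C)}"
      using countable_basics[of F] F by (auto simp: countable_finite)
    moreover have "countable (\<psi> U)" if "X closure_of U \<subseteq> \<Union>(B - C)" for U
      using \<psi>[OF that] by (simp add: countable_finite)
    moreover have "countable {V \<in> B. U \<subseteq> V}" if "U \<in> F" for U
      using B_countable F that by blast
    ultimately show "countable (\<Phi> F)"
      unfolding \<Phi>_def using F by (intro countable_Un countable_UN countable_image) (auto simp: countable_finite)
    have "s ` F \<subseteq> B" using s F by blast
    moreover have "c ` \<T> F \<subseteq> B" using c unfolding \<T>_def by blast
    moreover have "(\<Union>U\<in>{U \<in> basics F. X closure_of U \<subseteq> \<Union>(B - C)}. \<psi> U) \<subseteq> B" using \<psi> by blast
    ultimately show "\<Phi> F \<subseteq> B" unfolding \<Phi>_def by auto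
  qed
  have "\<exists>D. Y \<subseteq> D \<and> D \<subseteq> B \<and> countable D \<and> (\<forall>F. finite F \<longrightarrow> F \<subseteq> D \<longrightarrow> \<Phi> F \<subseteq> D)"
    using \<Phi> Y by (rule countable_closure)
  then obtain D where D: "Y \<subseteq> D" "D \<subseteq> B" "countable D"
    "\<And>F. finite F \<Longrightarrow> F \<subseteq> D \<Longrightarrow> \<Phi> F \<subseteq> D" by auto
  have closed: "closed_family D"
    unfolding closed_family_def
  proof (intro conjI ballI allI impI)
    show "D \<subseteq> B" by fact
  next
    fix U V assume "U \<in> D" "V \<in> B" "U \<subseteq> V"
    then have "V \<in> \<Phi> {U}" by (auto simp: \<Phi>_def)
    then show "V \<in> D" using D(4)[of "{U}"] \<open>U \<in> D\<close> by auto
  next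
    fix V assume "V \<in> D"
    then have "s V \<in> \<Phi> {V}" "X closure_of s V \<subseteq> V" using s D(2) by (auto simp: \<Phi>_def)
    then show "\<exists>V'\<in>D. X closure_of V' \<subseteq> V" using D(4)[of "{V}"] \<open>V \<in> D\<close> by auto
  next
    fix T W assume T: "finite T" "T \<subseteq> Fpow (coords D) \<times> Fpow (coords D)"
      and W: "openin X W" "W \<noteq> {}" "W \<subseteq> f ` \<Union>(cylinder I ` T)"
    obtain F where F: "finite F" "F \<subseteq> D" "T \<subseteq> Fpow (coords F) \<times> Fpow (coords F)"
      using finite_subset_cylinders[OF T] by blast
    have int: "X interior_of (f ` \<Union>(cylinder I ` T)) \<noteq> {}"
      using interior_of_maximal[OF W(3,1)] W(2) by blast
    then have "T \<in> \<T> F" using T(1) F(3) by (simp add: \<T>_def Fpow_def)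
    then have "c T \<in> \<Phi> F" by (simp add: \<Phi>_def)
    then have "c T \<in> D" using D(4)[OF F(1,2)] by blast
    then show "\<exists>V\<in>D. V \<subseteq> f ` \<Union>(cylinder I ` T)" using c[OF int] by blast
  qed
  \<comment> \<open>Lying below a single member of \<open>B - C\<close> passes to smaller sets, so
    the candidates are downward closed as \<open>countable_family_refinement\<close>
    demands.\<close>
  define E' where "E' = {U \<in> basics D. U \<noteq> {} \<and> (\<exists>V\<in>B - C. U \<subseteq> V)}"
  have "\<exists>A\<subseteq>E'. (\<forall>U\<in>A. finite {V\<in>A. U \<subseteq> V}) \<and> (\<forall>U\<in>E'. \<forall>p\<in>U. \<exists>V\<in>A. p \<in> V \<and> V \<subseteq> U)"
  proof (rule countable_family_refinement[OF compact countable_basics[OF D(3)]])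
    show "\<And>U p. U \<in> basics D \<Longrightarrow> p \<in> U \<Longrightarrow> \<exists>V\<in>basics D. p \<in> V \<and> X closure_of V \<subseteq> U"
      using basics_regular D(2) by blast
    show "\<And>U w p. U \<in> basics D \<Longrightarrow> w \<in> U \<Longrightarrow> p \<in> topspace X - U \<Longrightarrow> \<exists>V\<in>basics D. p \<in> V \<and> w \<notin> V"
      using basics_separate by blast
    show "\<And>U V. U \<in> E' \<Longrightarrow> V \<in> basics D \<Longrightarrow> V \<subseteq> U \<Longrightarrow> V \<noteq> {} \<Longrightarrow> V \<in> E'"
      unfolding E'_def by blast
  qed (use basics_open[OF _ D(2)] basics_Int in \<open>auto simp: E'_def\<close>)
  then obtain A where *: "A \<subseteq> E' \<and> (\<forall>U\<in>A. finite {V\<in>A. U \<subseteq> V}) \<and>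
      (\<forall>U\<in>E'. \<forall>p\<in>U. \<exists>V\<in>A. p \<in> V \<and> V \<subseteq> U)" ..
  have A: "A \<subseteq> E'" "\<forall>U\<in>A. finite {V\<in>A. U \<subseteq> V}"
      "\<And>U p. U \<in> E' \<Longrightarrow> p \<in> U \<Longrightarrow> \<exists>V\<in>A. p \<in> V \<and> V \<subseteq> U"
    using * by simp_all
  have "\<exists>V\<in>A. p \<in> V \<and> V \<subseteq> U" if U: "U \<in> basics D" "U \<subseteq> \<Union>(B - C)" "p \<in> U" for U p
  proof -
    \<comment> \<open>\<open>\<psi>\<close> is specified only for sets whose closure is covered by
      \<open>B - C\<close>, hence the passage from \<open>U\<close> to \<open>W\<close>.\<close>
    obtain W where W: "W \<in> basics D" "p \<in> W" "X closure_of W \<subseteq> U" using basics_regular U D(2) by blast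
    obtain F where F: "finite F" "F \<subseteq> D" "W \<in> basics F" using finite_subset_basics[OF W(1)] by blast
    have clW: "X closure_of W \<subseteq> \<Union>(B - C)" using W U by auto
    then have "\<psi> W \<subseteq> \<Phi> F" using F by (auto simp: \<Phi>_def)
    then have \<psi>D: "\<psi> W \<subseteq> D" using D(4)[OF F(1,2)] by blast
    have "p \<in> X closure_of W"
      using W closure_of_subset[OF openin_subset[OF basics_open[OF W(1) D(2)]]] by blast
    then obtain V' V where V: "V' \<in> \<psi> W" "V \<in> \<psi> W - C" "p \<in> V'" "X closure_of V' \<subseteq> V"
      using \<psi>[OF clW] by blast
    then have z: "(V', V) \<in> pairs D" using \<psi>D by (auto simp: pairs_def)
    define N where "N = {x \<in> topspace X. 1/2 < sep_fun (V', V) x}"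
    have N: "N \<in> basics D" "V' \<subseteq> N" "N \<subseteq> V"
      using sep_nbhd[OF z D(2)] unfolding N_def by simp_all
    have pN: "p \<in> U \<inter> N" using N(2) V U by auto
    have "V \<in> B - C" using V \<psi>D D(2) by blast
    then have "U \<inter> N \<in> E'"
      unfolding E'_def using basics_Int[OF U(1) N(1)] pN N(3) by (intro CollectI conjI) auto
    from A(3)[OF this pN] show ?thesis by blast
  qed
  then have "refined D C A"
    unfolding refined_def using closed A(1,2) by (auto simp: E'_def)
  then show ?thesis using D by blast
qed

text \<open>The chain matters for the reflection of interiors: a finite set of codes uses the
  coordinates of finitely many members, which lie in one link.\<close>

lemma closed_family_Union:
  assumes "\<And>D. D \<in> \<D> \<Longrightarrow> closed_family D" "\<D> \<noteq> {}" and chain: "subset.chain UNIV \<D>"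
  shows "closed_family (\<Union>\<D>)"
  unfolding closed_family_def
proof (intro conjI ballI allI impI)
  show "\<Union>\<D> \<subseteq> B" using closed_familyD(1)[OF assms(1)] by blast
next
  fix U V assume "U \<in> \<Union>\<D>" "V \<in> B" "U \<subseteq> V"
  then show "V \<in> \<Union>\<D>" using closed_familyD(2)[OF assms(1)] by blast
next
  fix V assume "V \<in> \<Union>\<D>"
  then show "\<exists>V'\<in>\<Union>\<D>. X closure_of V' \<subseteq> V" using closed_familyD(3)[OF assms(1)] by blast
next
  fix T W assume T: "finite T" "T \<subseteq> Fpow (coords (\<Union>\<D>)) \<times> Fpow (coords (\<Union>\<D>))"
    and W: "openin X W" "W \<noteq> {}" "W \<subseteq> f ` \<Union>(cylinder I ` T)"
  obtain F where F: "finite F" "F \<subseteq> \<Union>\<D>" "T \<subseteq> Fpow (coords F) \<times> Fpow (coords F)"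
    using finite_subset_cylinders[OF T] by blast
  obtain D where D: "D \<in> \<D>" "F \<subseteq> D" using finite_subset_Union_chain[OF F(1,2) assms(2) chain] .
  have "T \<subseteq> Fpow (coords D) \<times> Fpow (coords D)"
    using F(3) Fpow_mono[OF coords_mono[OF D(2)]] by blast
  from closed_familyD(4)[OF assms(1)[OF D(1)] T(1) this W] D(1)
  show "\<exists>V\<in>\<Union>\<D>. V \<subseteq> f ` \<Union>(cylinder I ` T)" by blast
qed

end

section \<open>Well-ordered unions of closed families\<close>

lemma underS_cases:
  assumes "Well_order r" "x \<in> Field r" "y \<in> Field r"
  shows "y = x \<or> y \<in> underS r x \<or> x \<in> underS r y"
  using assms by (auto simp: order_on_defs total_on_def underS_def)

lemma underS_trans:
  assumes "Well_order r" "x \<in> underS r y" "y \<in> underS r z"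
  shows "x \<in> underS r z"
  using assms unfolding underS_def order_on_defs trans_def antisym_def by blast

lemma subset_chain_subset: "subset.chain S \<C> \<Longrightarrow> \<D> \<subseteq> \<C> \<Longrightarrow> subset.chain S \<D>"
  unfolding subset_chain_def by (meson order_trans subsetD)

lemma card_of_insert_infinite_ordLeq:
  assumes "|A| \<le>o |C|" "infinite C"
  shows "|insert x A| \<le>o |C|"
proof -
  have "|{x}| \<le>o |C|" using assms(2) by (intro card_of_singl_ordLeq) auto
  then have "|{x} \<union> A| \<le>o |C|" using assms by (intro card_of_Un_ordLeq_infinite_Field) (auto simp: Field_card_of card_of_card_order_on)
  then show ?thesis by simp
qed

lemma card_of_Plus_nat_ordLess:
  assumes "|A| <o |Y|" "uncountable Y"
  shows "|A <+> (UNIV :: nat set)| <o |Y|"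
proof (rule card_of_Plus_ordLess_infinite)
  show "infinite Y" using assms(2) countable_finite by blast
  have "\<not> |Y| \<le>o |UNIV :: nat set|" using assms(2) by (simp add: countable_card_of_nat)
  then show "|UNIV :: nat set| <o |Y|"
    using not_ordLeq_iff_ordLess[OF card_of_Well_order card_of_Well_order] by blast
qed (fact assms(1))

context dyadic_base
begin

definition upper :: "'b set set \<Rightarrow> bool" where
  "upper C \<longleftrightarrow> (\<forall>U\<in>C. \<forall>V\<in>B. U \<subseteq> V \<longrightarrow> V \<in> C)"

text \<open>A basic set around \<open>q\<close> inside a member outside \<open>C\<close> and a
  member outside \<open>L\<close> avoids both families, since upward closure would otherwise pull
  one of these members in.\<close>

lemma upper_nbhd:
  assumes "upper C" "upper L" "q \<in> \<Union>(B - C)" "q \<in> \<Union>(B - L)"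
  shows "q \<in> \<Union>(B - (C \<union> L))"
proof -
  obtain V W where VW: "V \<in> B - C" "q \<in> V" "W \<in> B - L" "q \<in> W" using assms by blast
  then obtain S where "S \<in> B" "q \<in> S" "S \<subseteq> V \<inter> W"
    using B_nbhd[of "V \<inter> W" q] B_open by (metis DiffD1 IntI openin_Int)
  moreover from this have "S \<notin> C" "S \<notin> L" using VW assms(1,2) unfolding upper_def by blast+
  ultimately show ?thesis by blast
qed

lemma basics_INT:
  assumes "finite Q" "\<And>q. q \<in> Q \<Longrightarrow> u q \<in> basics D" "U \<in> basics D"
  shows "U \<inter> (\<Inter>q\<in>Q. u q) \<in> basics D"
  using assms
proof (induction Q rule: finite_induct)
  case (insert q Q)
  have "U \<inter> (\<Inter>q\<in>insert q Q. u q) = u q \<inter> (U \<inter> (\<Inter>q\<in>Q. u q))" by auto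
  then show ?case using insert basics_Int[of "u q" D "U \<inter> (\<Inter>q\<in>Q. u q)"] by simp
qed simp

text \<open>If \<open>p\<close> first becomes visible inside \<open>U\<close> at \<open>D\<close>, then it has a neighbourhood visible from \<open>D\<close>
  that avoids every point whose basic neighbourhoods all belong to the earlier stage \<open>L\<close>: the functions
  from \<open>L\<close> already separate such a point from \<open>p\<close>.\<close>

lemma visible_nbhd:
  assumes LD: "L \<subseteq> D" and DB: "D \<subseteq> B" and U: "U \<in> basics D" "p \<in> U"
    and first: "\<And>W. L \<noteq> {} \<Longrightarrow> W \<in> basics L \<Longrightarrow> p \<in> W \<Longrightarrow> \<not> W \<subseteq> U"
  shows "\<exists>W\<in>basics D. p \<in> W \<and> W \<subseteq> U \<and> W \<subseteq> \<Union>(B - L)"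
proof -
  define Z where "Z = topspace X - \<Union>(B - L)"
  have Z: "closedin X Z" unfolding Z_def using B_open by (intro closedin_diff) auto
  have sep: "\<exists>W\<in>basics D. p \<in> W \<and> q \<notin> X closure_of W" if q: "q \<in> Z" for q
  proof (cases "q \<in> U")
    case False
    then show ?thesis using basics_regular[OF U(1) DB U(2)] by blast
  next
    case True
    then obtain V where V: "V \<in> B" "q \<in> V" "V \<subseteq> U" using B_nbhd basics_open[OF U(1) DB] by blast
    obtain V' where V': "V' \<in> B" "q \<in> V'" "X closure_of V' \<subseteq> V" using regular_nbhd[OF B_open[OF V(1)] V(2)] by blast
    have "V \<in> L" "V' \<in> L" using q V V' by (auto simp: Z_def)
    then have z: "(V', V) \<in> pairs L" using V' by (simp add: pairs_def)
    have LB: "L \<subseteq> B" using LD DB by auto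
    have zD: "(V', V) \<in> pairs D" and zB: "(V', V) \<in> pairs B"
      using z pairs_mono LD LB by blast+
    have pX: "p \<in> topspace X" using U openin_subset[OF basics_open[OF U(1) DB]] by blast
    \<comment> \<open>A value above 1/2 would give \<open>p\<close> a neighbourhood visible from
      \<open>L\<close> inside \<open>U\<close>, against \<open>first\<close>; the level 3/4 then
      separates \<open>p\<close> from \<open>q\<close>, where the function is 1.\<close>
    have "sep_fun (V', V) p \<le> 1/2"
    proof (rule ccontr)
      assume "\<not> sep_fun (V', V) p \<le> 1/2"
      then have "p \<in> {x \<in> topspace X. 1/2 < sep_fun (V', V) x}" using pX by simp
      then show False using first[OF _ sep_nbhd(1)[OF z LB]] \<open>V \<in> L\<close> sep_nbhd(3)[OF z LB] V(3) by auto
    qed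
    moreover have "sep_fun (V', V) q = 1"
      using sep_fun(2)[OF zB, of q] B_subset_closure[OF V'(1)] V'(2) by auto
    moreover have "X closure_of {x \<in> topspace X. sep_fun (V', V) x < 3/4}
        \<subseteq> {x \<in> topspace X. sep_fun (V', V) x \<le> 3/4}"
      by (rule closure_of_minimal[OF _ sep_fun_open(4)[OF zB]]) auto
    moreover have "{x \<in> topspace X. sep_fun (V', V) x < 3/4} \<in> basics D"
      by (intro basics_lt[OF zD] Rats_divide) simp_all
    ultimately show ?thesis using pX
      by (intro bexI[of _ "{x \<in> topspace X. sep_fun (V', V) x < 3/4}"]) auto
  qed
  then obtain w where w: "\<And>q. q \<in> Z \<Longrightarrow> w q \<in> basics D \<and> p \<in> w q \<and> q \<notin> X closure_of (w q)" by metis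
  \<comment> \<open>The set \<open>Z\<close> to be avoided is compact, so finitely many of these
    neighbourhoods together avoid all of it.\<close>
  have "compactin X Z" using compact closedin_compact_space Z by blast
  moreover have "\<forall>S\<in>(\<lambda>q. topspace X - X closure_of (w q)) ` Z. openin X S" by auto
  moreover have "Z \<subseteq> \<Union>((\<lambda>q. topspace X - X closure_of (w q)) ` Z)" using w by (auto simp: Z_def)
  ultimately obtain \<F> where \<F>: "finite \<F>" "\<F> \<subseteq> (\<lambda>q. topspace X - X closure_of (w q)) ` Z" "Z \<subseteq> \<Union>\<F>"
    unfolding compactin_def by meson
  obtain Q where Q: "Q \<subseteq> Z" "finite Q" "\<F> = (\<lambda>q. topspace X - X closure_of (w q)) ` Q"
    using finite_subset_image[OF \<F>(1,2)] by blast
  let ?W = "U \<inter> (\<Inter>q\<in>Q. w q)"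
  have W: "?W \<in> basics D" using Q w U(1) by (intro basics_INT) auto
  have "x \<notin> Z" if x: "x \<in> ?W" for x
  proof
    assume "x \<in> Z"
    then obtain q where q: "q \<in> Q" "x \<notin> X closure_of (w q)" using \<F>(3) Q(3) by blast
    have "w q \<in> basics D" using q Q w by blast
    then have "w q \<subseteq> X closure_of (w q)"
      using closure_of_subset[OF openin_subset[OF basics_open[OF _ DB]]] by blast
    then show False using q x by blast
  qed
  then have "?W \<subseteq> \<Union>(B - L)" using openin_subset[OF basics_open[OF W DB]] by (auto simp: Z_def)
  moreover have "p \<in> ?W" using U(2) w Q(1) by blast
  ultimately show ?thesis using W by (intro bexI[of _ ?W] conjI) auto
qed

text \<open>Induction on the cardinality of \<open>Y\<close>, with \<open>C\<close> arbitrary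
  because each piece is refined relative to all earlier ones. \<open>Y\<close> is ordered as a
  cardinal, so the piece at \<open>x\<close> is grown from fewer than |Y| sets; adding
  \<open>nat\<close> to the bound absorbs the countable case.\<close>

lemma refined_exists:
  assumes "Y \<subseteq> B" "upper C"
  shows "\<exists>D A. Y \<subseteq> D \<and> |D| \<le>o |Y <+> (UNIV :: nat set)| \<and> refined D C A"
  using assms
proof (induction Y arbitrary: C rule: wf_induct_rule[OF wf_inv_image[OF wf_ordLess, of card_of]])
  case (1 Y)
  show ?case
  proof (cases "countable Y")
    case True
    then obtain D A where "Y \<subseteq> D" "countable D" "refined D C A" using refined_countable 1 by metis
    moreover have "|D| \<le>o |Y <+> (UNIV :: nat set)|"
      using \<open>countable D\<close> card_of_Plus2 ordLeq_transitive unfolding countable_card_of_nat by blast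
    ultimately show ?thesis by blast
  next
    case False
    define r where "r = |Y|"
    have wo: "Well_order r" and Fr: "Field r = Y" and co: "Card_order r"
      by (simp_all add: r_def Field_card_of card_of_card_order_on card_of_well_order_on)
    have wf: "wf (r - Id)" using wo by (simp add: well_order_on_def)
    have under_iff: "(y, x) \<in> r - Id \<longleftrightarrow> y \<in> underS r x" for x y by (auto simp: underS_def)
    define L where "L h x = (\<Union>y\<in>underS r x. fst (h y))" for h :: "'b set \<Rightarrow> 'b set set \<times> 'b set set" and x
    \<comment> \<open>The guard \<open>x \<in> Y\<close> makes the choice trivial outside the field,
      since the recursion runs over the whole type.\<close>
    define P where "P h x z \<longleftrightarrow> x \<in> Y \<longrightarrow> insert x (L h x) \<subseteq> fst z \<and>
      |fst z| \<le>o |underS r x <+> (UNIV :: nat set)| \<and> refined (fst z) (C \<union> L h x) (snd z)" for h x z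
    have "\<exists>h. \<forall>x. P h x (h x)"
    proof (rule dependent_wf_choice[OF wf])
      fix h g :: "'b set \<Rightarrow> 'b set set \<times> 'b set set" and x z assume "\<And>y. (y, x) \<in> r - Id \<Longrightarrow> h y = g y"
      then have "L h x = L g x" unfolding L_def under_iff by (metis (no_types, lifting) SUP_cong)
      then show "P h x z = P g x z" by (simp add: P_def)
    next
      fix x and h :: "'b set \<Rightarrow> 'b set set \<times> 'b set set" assume IH: "\<And>y. (y, x) \<in> r - Id \<Longrightarrow> P h y (h y)"
      show "\<exists>z. P h x z"
      proof (cases "x \<in> Y")
        case True
        have h: "refined (fst (h y)) (C \<union> L h y) (snd (h y))"
          "|fst (h y)| \<le>o |underS r x <+> (UNIV :: nat set)|" if y: "y \<in> underS r x" for y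
        proof -
          have "y \<in> Y" using y Fr unfolding underS_def Field_def by blast
          then have *: "|fst (h y)| \<le>o |underS r y <+> (UNIV :: nat set)|"
            "refined (fst (h y)) (C \<union> L h y) (snd (h y))"
            using IH y unfolding under_iff P_def by blast+
          have "underS r y \<subseteq> underS r x" using underS_trans[OF wo] y by blast
          then have "|underS r y <+> (UNIV :: nat set)| \<le>o |underS r x <+> (UNIV :: nat set)|"
            by (intro card_of_Plus_mono1 card_of_mono1)
          with * show "refined (fst (h y)) (C \<union> L h y) (snd (h y))"
            "|fst (h y)| \<le>o |underS r x <+> (UNIV :: nat set)|"
            using ordLeq_transitive by blast+
        qed
        note cl = closed_familyD[OF refinedD(1)[OF h(1)]]
        have inf: "infinite (underS r x <+> (UNIV :: nat set))" by simp
        have "|L h x| \<le>o |underS r x <+> (UNIV :: nat set)|"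
          unfolding L_def using h(2) by (intro card_of_UNION_ordLeq_infinite[OF inf] card_of_Plus1 ballI)
        then have card: "|insert x (L h x)| \<le>o |underS r x <+> (UNIV :: nat set)|"
          using inf by (rule card_of_insert_infinite_ordLeq)
        have "|underS r x| <o |Y|" using card_of_underS[OF co, of x] True Fr by (simp add: r_def)
        then have less: "|underS r x <+> (UNIV :: nat set)| <o |Y|"
          using False by (rule card_of_Plus_nat_ordLess)
        have "insert x (L h x) \<subseteq> B" using cl(1) True 1(2) by (auto simp: L_def)
        moreover have "upper (C \<union> L h x)"
          using 1(3) cl(2) unfolding upper_def L_def by blast
        moreover have "(insert x (L h x), Y) \<in> inv_image ordLess card_of"
          using ordLeq_ordLess_trans[OF card less] by simp
        ultimately obtain D A where DA: "insert x (L h x) \<subseteq> D"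
          "|D| \<le>o |insert x (L h x) <+> (UNIV :: nat set)|" "refined D (C \<union> L h x) A"
          using 1(1) by metis
        have "|insert x (L h x) <+> (UNIV :: nat set)| \<le>o |underS r x <+> (UNIV :: nat set)|"
          using card card_of_Plus2 inf by (intro card_of_Plus_ordLeq_infinite_Field) (auto simp: Field_card_of card_of_card_order_on)
        then have "P h x (D, A)" using DA ordLeq_transitive by (auto simp: P_def)
        then show ?thesis by blast
      qed (simp add: P_def)
    qed
    then obtain h where h: "\<And>x. P h x (h x)" by blast
    define D where "D x = fst (h x)" for x
    define A where "A x = snd (h x)" for x
    define M where "M x = L h x" for x
    have M: "M x = (\<Union>y\<in>underS r x. D y)" for x by (simp add: M_def L_def D_def)
    have xD: "x \<in> D x" and MD: "M x \<subseteq> D x" and Dcard: "|D x| \<le>o |underS r x <+> (UNIV :: nat set)|"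
      and ref: "refined (D x) (C \<union> M x) (A x)" if "x \<in> Y" for x
      using h[of x] that by (simp_all add: P_def D_def A_def M_def)
    note cl = refinedD(1)[OF ref] and cls = closed_familyD[OF refinedD(1)[OF ref]]
    have underY: "y \<in> Y" if "y \<in> underS r x" for x y
      using that Fr unfolding underS_def Field_def by blast
    have DM: "D y \<subseteq> M x" if "y \<in> underS r x" for x y using that by (auto simp: M)
    have chain: "subset.chain UNIV (D ` Y)"
    proof -
      have "D x \<subseteq> D y \<or> D y \<subseteq> D x" if "x \<in> Y" "y \<in> Y" for x y
        using underS_cases[OF wo, of x y] that Fr DM MD by blast
      then show ?thesis by (auto simp: subset_chain_def)
    qed
    have chainM: "subset.chain UNIV (D ` underS r x)" for x
      using underY by (intro subset_chain_subset[OF chain] image_mono subsetI)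
    have clM: "closed_family (M x)" if "underS r x \<noteq> {}" for x
      unfolding M
    proof (rule closed_family_Union[OF _ _ chainM])
      show "closed_family E" if "E \<in> D ` underS r x" for E using that cl underY by blast
      show "D ` underS r x \<noteq> {}" using that by simp
    qed
    have upM: "upper (M x)" for x
      unfolding upper_def
    proof (intro ballI impI)
      fix U V assume "U \<in> M x" "V \<in> B" "U \<subseteq> V"
      then obtain y where "y \<in> underS r x" "U \<in> D y" by (auto simp: M)
      then show "V \<in> M x" using cls(2)[OF underY] \<open>V \<in> B\<close> \<open>U \<subseteq> V\<close> DM by blast
    qed
    have Yne: "Y \<noteq> {}" using False by auto
    define DD where "DD = \<Union>(D ` Y)"
    define AA where "AA = \<Union>(A ` Y)"
    have "closed_family DD" unfolding DD_def
    proof (rule closed_family_Union[OF _ _ chain])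
      show "closed_family E" if "E \<in> D ` Y" for E using that cl by blast
      show "D ` Y \<noteq> {}" using Yne by simp
    qed
    have YD: "Y \<subseteq> DD" using xD by (auto simp: DD_def)
    have card: "|DD| \<le>o |Y <+> (UNIV :: nat set)|"
      unfolding DD_def
    proof (rule card_of_UNION_ordLeq_infinite, simp, rule card_of_Plus1, rule ballI)
      fix x assume "x \<in> Y"
      have "|underS r x| \<le>o |Y|" using underY by (intro card_of_mono1) blast
      then show "|D x| \<le>o |Y <+> (UNIV :: nat set)|"
        using ordLeq_transitive[OF Dcard[OF \<open>x \<in> Y\<close>] card_of_Plus_mono1] by blast
    qed
    have AA: "AA \<subseteq> basics DD"
    proof
      fix U assume "U \<in> AA"
      then obtain x where x: "x \<in> Y" "U \<in> A x" by (auto simp: AA_def)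
      then have "D x \<subseteq> DD" by (auto simp: DD_def)
      then show "U \<in> basics DD" using basics_mono refinedD(2)[OF ref[OF x(1)]] x(2) by blast
    qed
    have inner: "U \<noteq> {} \<and> (\<exists>V\<in>B - C. U \<subseteq> V)" if U: "U \<in> AA" for U
    proof -
      obtain x where x: "x \<in> Y" "U \<in> A x" using U by (auto simp: AA_def)
      then show ?thesis using refinedD(3,4)[OF ref[OF x(1)] x(2)] by blast
    qed
    have fin: "x \<in> Y \<Longrightarrow> \<forall>U\<in>A x. finite {V \<in> AA. U \<subseteq> V}" for x
    proof (induction x rule: wf_induct_rule[OF wf])
      case (1 x)
      show ?case
      proof
        fix U assume U: "U \<in> A x"
        have UD: "U \<in> basics (D x)" and Une: "U \<noteq> {}" and Uop: "openin X U"
          using U refinedD(2,3)[OF ref[OF 1(2)]] basics_open cls(1)[OF 1(2)] by blast+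
        \<comment> \<open>\<open>U\<close> contains some \<open>W\<close> of \<open>D x\<close>. The
          member \<open>S\<close> of B above \<open>V\<close> would contain \<open>W\<close>, hence
          lie in \<open>D x\<close> and so in \<open>M y\<close>, which it avoids.\<close>
        have late: "V \<notin> A y" if y: "x \<in> underS r y" and UV: "U \<subseteq> V" for y V
        proof
          assume V: "V \<in> A y"
          have yY: "y \<in> Y" using y Fr unfolding underS_def Field_def by blast
          obtain S where S: "S \<in> B - (C \<union> M y)" "V \<subseteq> S" using refinedD(4)[OF ref[OF yY] V] by blast
          obtain W where "W \<in> D x" "W \<subseteq> U" using projection[OF cl[OF 1(2)] Uop Une] UD by blast
          then have "S \<in> D x" using cls(2)[OF 1(2)] S UV by blast
          then show False using S DM[OF y] by blast
        qed
        have "finite {V \<in> \<Union>(A ` underS r x). U \<subseteq> V}"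
        proof (cases "{V \<in> \<Union>(A ` underS r x). U \<subseteq> V} = {}")
          case False
          then obtain V0 y0 where V0: "y0 \<in> underS r x" "V0 \<in> A y0" "U \<subseteq> V0" by blast
          have vis: "V \<in> basics (M x)" if "V \<in> A y" "y \<in> underS r x" for V y
            using that refinedD(2)[OF ref[OF underY[OF that(2)]]] basics_mono[OF DM[OF that(2)]] by blast
          \<comment> \<open>All earlier supersets of \<open>U\<close> are visible from
            \<open>M x\<close>, so one \<open>W\<close> in \<open>M x\<close> lies in all of them,
            and it suffices to bound the supersets of \<open>W\<close>.\<close>
          have "closed_family (M x)" using clM V0 by blast
          from projection[OF this Uop Une] obtain W where W: "W \<in> M x"
            "\<And>V. V \<in> basics (M x) \<Longrightarrow> U \<subseteq> V \<Longrightarrow> W \<subseteq> V" by blast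
          have WC: "W \<notin> C"
          proof
            assume "W \<in> C"
            obtain S where S: "S \<in> B - (C \<union> M y0)" "V0 \<subseteq> S"
              using refinedD(4)[OF ref[OF underY[OF V0(1)]] V0(2)] by blast
            have "W \<subseteq> S" using W(2)[OF vis[OF V0(2,1)] V0(3)] S by blast
            then show False using \<open>upper C\<close> \<open>W \<in> C\<close> S unfolding upper_def by blast
          qed
          \<comment> \<open>At the first stage \<open>x0\<close> that contains \<open>W\<close> it
            is new, so a chosen set \<open>S\<close> lies below it; \<open>S\<close> has finitely
            many supersets by induction.\<close>
          have "{y \<in> underS r x. W \<in> D y} \<noteq> {}" using W(1) by (auto simp: M)
          then obtain x0 where x0: "x0 \<in> underS r x" "W \<in> D x0"
            "\<And>y. y \<in> underS r x0 \<Longrightarrow> \<not> (y \<in> underS r x \<and> W \<in> D y)"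
            using wfE_min'[OF wf] unfolding under_iff by (metis (no_types, lifting) mem_Collect_eq)
          then have "W \<notin> M x0" using underS_trans[OF wo _ x0(1)] by (auto simp: M)
          then obtain S where S: "S \<in> A x0" "S \<subseteq> W"
            using refined_below[OF ref[OF underY[OF x0(1)]] x0(2)] WC by blast
          have "(x0, x) \<in> r - Id" using x0(1) under_iff by blast
          then have "finite {V \<in> AA. S \<subseteq> V}" using 1(1) S(1) underY[OF x0(1)] by blast
          moreover have "{V \<in> \<Union>(A ` underS r x). U \<subseteq> V} \<subseteq> {V \<in> AA. S \<subseteq> V}"
          proof
            fix V assume "V \<in> {V \<in> \<Union>(A ` underS r x). U \<subseteq> V}"
            then obtain y where y: "y \<in> underS r x" "V \<in> A y" "U \<subseteq> V" by auto
            then have "W \<subseteq> V" using W(2) vis by blast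
            moreover have "V \<in> AA" using y underY by (auto simp: AA_def)
            ultimately show "V \<in> {V \<in> AA. S \<subseteq> V}" using S(2) by auto
          qed
          ultimately show ?thesis by (rule rev_finite_subset)
        next
          case True
          show ?thesis unfolding True by simp
        qed
        moreover have "finite {V \<in> A x. U \<subseteq> V}" using refinedD(5)[OF ref[OF 1(2)] U] .
        moreover have "{V \<in> AA. U \<subseteq> V} \<subseteq> {V \<in> A x. U \<subseteq> V} \<union> {V \<in> \<Union>(A ` underS r x). U \<subseteq> V}"
        proof
          fix V assume "V \<in> {V \<in> AA. U \<subseteq> V}"
          then obtain y where y: "y \<in> Y" "V \<in> A y" "U \<subseteq> V" by (auto simp: AA_def)
          then have "x \<notin> underS r y" using late by blast
          then have "y = x \<or> y \<in> underS r x" using underS_cases[OF wo, of x y] y(1) 1(2) Fr by auto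
          then show "V \<in> {V \<in> A x. U \<subseteq> V} \<union> {V \<in> \<Union>(A ` underS r x). U \<subseteq> V}" using y by auto
        qed
        ultimately show "finite {V \<in> AA. U \<subseteq> V}" by (meson finite_UnI finite_subset)
      qed
    qed
    have base: "\<exists>V\<in>AA. p \<in> V \<and> V \<subseteq> U" if U: "U \<in> basics DD" "U \<subseteq> \<Union>(B - C)" "p \<in> U" for U p
    proof -
      have down: "\<exists>y\<in>S. U' \<in> basics (D y)" if U': "U' \<in> basics (\<Union>(D ` S))" "S \<noteq> {}" "S \<subseteq> Y" for U' S
      proof -
        obtain F where F: "finite F" "F \<subseteq> \<Union>(D ` S)" "U' \<in> basics F" using finite_subset_basics[OF U'(1)] by blast
        have "subset.chain UNIV (D ` S)" using U'(3) by (intro subset_chain_subset[OF chain] image_mono)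
        then obtain Dy where "Dy \<in> D ` S" "F \<subseteq> Dy"
          using finite_subset_Union_chain[OF F(1,2)] U'(2) by blast
        then show ?thesis using basics_mono F(3) by blast
      qed
      \<comment> \<open>These are the stages that see a neighbourhood of \<open>p\<close> inside
        \<open>U\<close>; at the first of them \<open>visible_nbhd\<close> applies.\<close>
      define S where "S = {x \<in> Y. \<exists>W\<in>basics (D x). p \<in> W \<and> W \<subseteq> U}"
      have "S \<noteq> {}" using down[of U Y] U Yne by (auto simp: S_def DD_def)
      then obtain x where x: "x \<in> S" "\<And>y. y \<in> underS r x \<Longrightarrow> y \<notin> S"
        using wfE_min'[OF wf] unfolding under_iff by metis
      then obtain U1 where U1: "U1 \<in> basics (D x)" "p \<in> U1" "U1 \<subseteq> U" and xY: "x \<in> Y" by (auto simp: S_def)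
      \<comment> \<open>\<open>basics {}\<close> still contains the whole space, so at the least
        stage, where nothing is earlier, minimality gives no information; hence the condition
        \<open>M x \<noteq> {}\<close>.\<close>
      have "\<not> W \<subseteq> U1" if W: "M x \<noteq> {}" "W \<in> basics (M x)" "p \<in> W" for W
      proof
        assume WU: "W \<subseteq> U1"
        have "underS r x \<noteq> {}" using W(1) by (auto simp: M)
        then obtain y where "y \<in> underS r x" "W \<in> basics (D y)"
          using down[of W "underS r x"] W(2) underY M by (metis subsetI)
        then have "y \<in> S" using W(3) WU U1(3) underY[of y x] by (auto simp: S_def)
        then show False using x(2) \<open>y \<in> underS r x\<close> by blast
      qed
      then obtain W where W: "W \<in> basics (D x)" "p \<in> W" "W \<subseteq> U1" "W \<subseteq> \<Union>(B - M x)"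
        using visible_nbhd[OF MD[OF xY] cls(1)[OF xY] U1(1,2)] by metis
      have "W \<subseteq> \<Union>(B - C)" using W(3) U1(3) U(2) by (meson order_trans)
      then have "W \<subseteq> \<Union>(B - (C \<union> M x))"
        using upper_nbhd[OF \<open>upper C\<close> upM] W(4) by (intro subsetI) (meson subsetD)
      then obtain V where "V \<in> A x" "p \<in> V" "V \<subseteq> W" using refinedD(6)[OF ref[OF xY] W(1) _ W(2)] by blast
      moreover have "V \<in> AA" using \<open>V \<in> A x\<close> xY by (auto simp: AA_def)
      ultimately show ?thesis using W(3) U1(3) by blast
    qed
    have "refined DD C AA"
      unfolding refined_def using \<open>closed_family DD\<close> AA inner fin base by (auto simp: AA_def)
    then show ?thesis using YD card by blast
  qed
qed

text \<open>Starting from \<open>Y = B\<close> and \<open>C = {}\<close> forces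
  \<open>D = B\<close>; \<open>sep_nbhd\<close> then puts a visible set inside every neighbourhood,
  so the chosen sets form a base.\<close>

lemma finite_superset_base:
  "\<exists>A. is_base X A \<and> (\<forall>U\<in>A. finite {V \<in> A. U \<subseteq> V})"
proof -
  have "upper {}" by (simp add: upper_def)
  then obtain D A where "B \<subseteq> D" and ref: "refined D {} A" using refined_exists[of B "{}"] by blast
  then have DB: "D = B" using closed_familyD(1)[OF refinedD(1)] by blast
  have "\<exists>V\<in>A. p \<in> V \<and> V \<subseteq> U" if U: "openin X U" "p \<in> U" for U p
  proof -
    obtain V where V: "V \<in> B" "p \<in> V" "V \<subseteq> U" using B_nbhd U by blast
    obtain V' where V': "V' \<in> B" "p \<in> V'" "X closure_of V' \<subseteq> V" using regular_nbhd[OF B_open[OF V(1)] V(2)] by blast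
    have z: "(V', V) \<in> pairs B" using V V' by (simp add: pairs_def)
    note N = sep_nbhd[OF z order_refl]
    have "{x \<in> topspace X. 1/2 < sep_fun (V', V) x} \<subseteq> \<Union>(B - {})" using N(3) V(1) by auto
    moreover have "p \<in> {x \<in> topspace X. 1/2 < sep_fun (V', V) x}" using N(2) V'(2) by auto
    ultimately obtain W where "W \<in> A" "p \<in> W" "W \<subseteq> {x \<in> topspace X. 1/2 < sep_fun (V', V) x}"
      using refinedD(6)[OF ref, unfolded DB, OF N(1)] by blast
    then show ?thesis using N(3) V(3) by auto
  qed
  moreover have "openin X U" if "U \<in> A" for U
    using that refinedD(2)[OF ref] basics_open DB by blast
  ultimately have "is_base X A" unfolding is_base_def openin_topology_base_unique by blast
  then show ?thesis using refinedD(5)[OF ref] by blast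
qed

end

section \<open>Exclusion of omega_1\<close>

lemma is_base_iff:
  "is_base X B \<longleftrightarrow> (\<forall>V\<in>B. openin X V) \<and> (\<forall>U p. openin X U \<longrightarrow> p \<in> U \<longrightarrow> (\<exists>V\<in>B. p \<in> V \<and> V \<subseteq> U))"
  unfolding is_base_def openin_topology_base_unique by meson

lemma Card_order_infinite_iff:
  assumes "Card_order \<kappa>"
  shows "infinite (Field \<kappa>) \<longleftrightarrow> natLeq \<le>o \<kappa>"
proof -
  have iso: "|Field \<kappa>| =o \<kappa>" using card_of_Field_ordIso[OF assms] .
  show ?thesis
    using infinite_iff_natLeq_ordLeq[of "Field \<kappa>"]
      ordLeq_ordIso_trans[OF _ iso] ordLeq_ordIso_trans[OF _ ordIso_symmetric[OF iso]] by blast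
qed

lemma finite_ordLess_Card_order:
  assumes "finite A" "Card_order \<kappa>" "infinite (Field \<kappa>)"
  shows "|A| <o \<kappa>"
  using assms Card_order_infinite_iff[OF assms(2)]
  by (intro ordLess_ordLeq_trans[of "|A|" natLeq \<kappa>]) (simp_all add: finite_iff_ordLess_natLeq)

lemma dyadic_not_Nt_omega1:
  fixes X :: "'b topology"
  assumes "dyadic_compactum TYPE('i) X"
  shows "\<not> Nt_eq X (cardSuc natLeq)"
proof
  assume Nt: "Nt_eq X (cardSuc natLeq)"
  then obtain B0 where B0: "is_base X B0" "op_like B0 (cardSuc natLeq)"
    by (auto simp: Nt_eq_def has_op_like_base_def)
  obtain I :: "'i set" and f where f: "Hausdorff_space X" "continuous_map (cantor_cube I) X f"
    "f ` topspace (cantor_cube I) = topspace X"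
    using assms by (auto simp: dyadic_compactum_def)
  interpret dyadic_base X I f "B0 - {{}}"
  proof
    show "Hausdorff_space X" "continuous_map (cantor_cube I) X f"
      "f ` topspace (cantor_cube I) = topspace X" by (fact f)+
    show "openin X V" if "V \<in> B0 - {{}}" for V using that B0(1) by (simp add: is_base_iff)
    show "\<exists>V\<in>B0 - {{}}. p \<in> V \<and> V \<subseteq> U" if "openin X U" "p \<in> U" for U p
      using that B0(1) unfolding is_base_iff by (metis Diff_iff empty_iff singletonD)
    show "countable {V \<in> B0 - {{}}. U \<subseteq> V}" if "U \<in> B0 - {{}}" for U
    proof -
      have "|{V \<in> B0. U \<subseteq> V}| <o cardSuc natLeq" using that B0(2) by (simp add: op_like_def)
      then have "countable {V \<in> B0. U \<subseteq> V}"
        unfolding countable_card_le_natLeq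
        using cardSuc_ordLeq_ordLess[OF natLeq_Card_order card_of_Card_order] by blast
      then show ?thesis by (rule countable_subset[rotated]) auto
    qed
  qed simp
  obtain A where A: "is_base X A" "\<And>U. U \<in> A \<Longrightarrow> finite {V \<in> A. U \<subseteq> V}"
    using finite_superset_base by blast
  have co: "Card_order (cardSuc natLeq)" by (rule cardSuc_Card_order[OF natLeq_Card_order])
  \<comment> \<open>Minimality in \<open>Nt_eq\<close> is tested on subsets of the field, so omega
    has to be represented by a countably infinite subset of the field of omega_1.\<close>
  have "infinite (Field (cardSuc natLeq))"
    using cardSuc_finite[OF natLeq_Card_order] Field_natLeq by simp
  then obtain g :: "nat \<Rightarrow> nat set" where g: "inj g" "range g \<subseteq> Field (cardSuc natLeq)"
    using infinite_countable_subset by blast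
  have inf: "infinite (range g)" using g(1) range_inj_infinite by blast
  have "|range g| \<le>o natLeq" using countable_card_le_natLeq by blast
  then have "|range g| <o cardSuc natLeq"
    using cardSuc_ordLeq_ordLess[OF natLeq_Card_order card_of_Card_order] by blast
  moreover have nat: "natLeq \<le>o |range g|" using inf infinite_iff_natLeq_ordLeq by blast
  moreover have "op_like A |range g|"
    unfolding op_like_def using A(2) nat finite_iff_ordLess_natLeq ordLess_ordLeq_trans by blast
  ultimately show False using Nt A(1) g(2) unfolding Nt_eq_def has_op_like_base_def by blast
qed

section \<open>Wedges of two Cantor cubes\<close>

text \<open>The cubes \<open>2^K\<close> and \<open>2^L\<close>, with disjoint \<open>K\<close> and \<open>L\<close>, glued at their zero points. Points are
  subsets of \<open>K\<close> or of \<open>L\<close>, the common point being the empty set.\<close>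

definition wedge_points :: "'j set \<Rightarrow> 'j set \<Rightarrow> 'j set set" where
  "wedge_points K L = Pow K \<union> Pow L"

text \<open>Points are read as characteristic functions: this is the subspace of the cube over
  \<open>K \<union> L\<close> of those supported in \<open>K\<close> or in \<open>L\<close>.\<close>

definition wedge :: "'j set \<Rightarrow> 'j set \<Rightarrow> 'j set topology" where
  "wedge K L = pullback_topology (wedge_points K L) (\<lambda>S. \<lambda>i\<in>K \<union> L. i \<in> S) (cantor_cube (K \<union> L))"

definition box :: "'j set \<Rightarrow> 'j set \<Rightarrow> 'j set \<Rightarrow> 'j set \<Rightarrow> 'j set set" where
  "box K L F P = {S \<in> wedge_points K L. S \<inter> F = P}"

lemma topspace_wedge: "topspace (wedge K L) = wedge_points K L"
  by (auto simp: wedge_def topspace_pullback_topology topspace_cantor_cube)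

lemma openin_box:
  assumes "finite F" "F \<subseteq> K \<union> L" "P \<subseteq> F"
  shows "openin (wedge K L) (box K L F P)"
  unfolding wedge_def openin_pullback_topology
proof (intro exI conjI)
  show "openin (cantor_cube (K \<union> L)) (cylinder (K \<union> L) (F, P))"
    using assms by (intro openin_cylinder) auto
  show "box K L F P = (\<lambda>S. \<lambda>i\<in>K \<union> L. i \<in> S) -` cylinder (K \<union> L) (F, P) \<inter> wedge_points K L"
    using assms(2,3) by (fastforce simp: box_def cylinder_def)
qed

lemma wedge_nbhd:
  assumes "openin (wedge K L) U" "S \<in> U"
  obtains F where "finite F" "F \<subseteq> K \<union> L" "box K L F (S \<inter> F) \<subseteq> U"
proof -
  obtain V where V: "openin (cantor_cube (K \<union> L)) V"
    "U = (\<lambda>S. \<lambda>i\<in>K \<union> L. i \<in> S) -` V \<inter> wedge_points K L"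
    using assms(1) unfolding wedge_def openin_pullback_topology by blast
  then have "(\<lambda>i\<in>K \<union> L. i \<in> S) \<in> V" using assms(2) by auto
  from cantor_cube_open_nbhd[OF V(1) this] obtain F where F: "finite F" "F \<subseteq> K \<union> L"
    "cylinder (K \<union> L) (F, {i \<in> F. (\<lambda>i\<in>K \<union> L. i \<in> S) i}) \<subseteq> V" .
  have "box K L F (S \<inter> F) \<subseteq> U"
  proof
    fix S' assume S': "S' \<in> box K L F (S \<inter> F)"
    have "(\<lambda>i\<in>K \<union> L. i \<in> S') \<in> cylinder (K \<union> L) (F, {i \<in> F. (\<lambda>i\<in>K \<union> L. i \<in> S) i})"
      using S' F(2) by (auto simp: box_def cylinder_def)
    then show "S' \<in> U" using F(3) S' V(2) by (auto simp: box_def)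
  qed
  then show ?thesis using that F by blast
qed

lemma continuous_map_finite_support:
  assumes "finite F" "F \<subseteq> I"
    and "\<And>x y. (\<And>i. i \<in> F \<Longrightarrow> x i = y i) \<Longrightarrow> h x = h y"
  shows "continuous_map (cantor_cube I) (discrete_topology UNIV) h"
  unfolding continuous_map_def
proof (intro conjI allI impI)
  fix U :: "'b set"
  show "openin (cantor_cube I) {x \<in> topspace (cantor_cube I). h x \<in> U}"
  proof (subst openin_subopen, intro ballI exI conjI)
    fix x assume x: "x \<in> {x \<in> topspace (cantor_cube I). h x \<in> U}"
    show "openin (cantor_cube I) (cylinder I (F, {i \<in> F. x i}))"
      using assms by (intro openin_cylinder)
    show "x \<in> cylinder I (F, {i \<in> F. x i})"
      using x by (simp add: cylinder_def topspace_cantor_cube)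
    show "cylinder I (F, {i \<in> F. x i}) \<subseteq> {x \<in> topspace (cantor_cube I). h x \<in> U}"
    proof
      fix y assume y: "y \<in> cylinder I (F, {i \<in> F. x i})"
      then have "h y = h x" by (intro assms(3)) (auto simp: cylinder_def)
      then show "y \<in> {x \<in> topspace (cantor_cube I). h x \<in> U}"
        using x y by (simp add: cylinder_def topspace_cantor_cube)
    qed
  qed
qed simp

lemma Hausdorff_space_wedge: "Hausdorff_space (wedge K L)"
  unfolding Hausdorff_space_def
proof (intro allI impI)
  fix S T :: "'a set" assume *: "S \<in> topspace (wedge K L) \<and> T \<in> topspace (wedge K L) \<and> S \<noteq> T"
  then obtain i where i: "i \<in> K \<union> L" "i \<in> S \<longleftrightarrow> i \<notin> T"
    by (auto simp: topspace_wedge wedge_points_def)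
  have "openin (wedge K L) (box K L {i} (S \<inter> {i}))" "openin (wedge K L) (box K L {i} (T \<inter> {i}))"
    using i(1) by (auto intro!: openin_box)
  moreover have "S \<in> box K L {i} (S \<inter> {i})" "T \<in> box K L {i} (T \<inter> {i})"
    using * by (auto simp: box_def topspace_wedge)
  moreover have "disjnt (box K L {i} (S \<inter> {i})) (box K L {i} (T \<inter> {i}))"
    using i(2) by (auto simp: box_def disjnt_iff)
  ultimately show "\<exists>U V. openin (wedge K L) U \<and> openin (wedge K L) V \<and> S \<in> U \<and> T \<in> V \<and> disjnt U V"
    by blast
qed

text \<open>The extra coordinate \<open>w\<close> selects one of the two cubes.\<close>

lemma dyadic_compactum_wedge:
  fixes K L :: "'j set"
  assumes "w \<notin> K \<union> L"
  shows "dyadic_compactum TYPE('j) (wedge K L)"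
proof -
  define h where "h x = (if x w then {i \<in> K. x i} else {i \<in> L. x i})" for x
  let ?C = "cantor_cube (insert w (K \<union> L))"
  have hW: "h x \<in> wedge_points K L" for x by (auto simp: h_def wedge_points_def)
  have "continuous_map ?C (cantor_cube (K \<union> L)) ((\<lambda>S. \<lambda>i\<in>K \<union> L. i \<in> S) \<circ> h)"
    unfolding cantor_cube_def[of "K \<union> L"] continuous_map_componentwise
  proof (intro conjI ballI)
    show "((\<lambda>S. \<lambda>i\<in>K \<union> L. i \<in> S) \<circ> h) ` topspace ?C \<subseteq> extensional (K \<union> L)" by auto
    fix k assume k: "k \<in> K \<union> L"
    show "continuous_map ?C (discrete_topology UNIV) (\<lambda>x. ((\<lambda>S. \<lambda>i\<in>K \<union> L. i \<in> S) \<circ> h) x k)"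
      by (rule continuous_map_finite_support[of "{w, k}"]) (use k in \<open>auto simp: h_def\<close>)
  qed
  then have cont: "continuous_map ?C (wedge K L) h"
    unfolding wedge_def by (rule continuous_map_pullback') (use hW in auto)
  moreover have "h ` topspace ?C = topspace (wedge K L)"
  proof
    show "h ` topspace ?C \<subseteq> topspace (wedge K L)" using hW by (auto simp: topspace_wedge)
    show "topspace (wedge K L) \<subseteq> h ` topspace ?C"
    proof
      fix S assume S: "S \<in> topspace (wedge K L)"
      define x where "x = (\<lambda>i\<in>insert w (K \<union> L). if i = w then S \<subseteq> K else i \<in> S)"
      have "S = h x" using S assms
        by (auto simp: h_def x_def topspace_wedge wedge_points_def)
      moreover have "x \<in> topspace ?C" by (auto simp: x_def topspace_cantor_cube)
      ultimately show "S \<in> h ` topspace ?C" by blast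
    qed
  qed
  ultimately show ?thesis
    unfolding dyadic_compactum_def using Hausdorff_space_wedge by blast
qed

text \<open>Near the common point the smaller cube provides few open sets, while a neighbourhood base
  must be large because of the bigger cube.\<close>

lemma wedge_base_large:
  fixes K L :: "'j set"
  assumes KL: "K \<inter> L = {}" and L: "infinite L" and B: "is_base (wedge K L) B" and op: "op_like B \<mu>"
  shows "\<exists>(Q :: 'j set \<Rightarrow> 'j set set set) N. (\<forall>G\<in>Fpow L. |Q G| <o \<mu>) \<and> (\<forall>V. finite (N V)) \<and> K \<subseteq> (\<Union>G\<in>Fpow L. \<Union>V\<in>Q G. N V)"
proof -
  have base: "\<And>V. V \<in> B \<Longrightarrow> openin (wedge K L) V"
    "\<And>U p. openin (wedge K L) U \<Longrightarrow> p \<in> U \<Longrightarrow> \<exists>V\<in>B. p \<in> V \<and> V \<subseteq> U"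
    using B unfolding is_base_iff by blast+
  have "\<exists>F. finite F \<and> (V \<in> B \<longrightarrow> {} \<in> V \<longrightarrow> F \<subseteq> K \<union> L \<and> box K L F {} \<subseteq> V)" for V
  proof (cases "V \<in> B \<and> {} \<in> V")
    case True
    then obtain F where "finite F" "F \<subseteq> K \<union> L" "box K L F ({} \<inter> F) \<subseteq> V" using wedge_nbhd base(1) by metis
    then show ?thesis by auto
  qed auto
  then obtain N where N: "\<And>V. finite (N V)" "\<And>V. V \<in> B \<Longrightarrow> {} \<in> V \<Longrightarrow> N V \<subseteq> K \<union> L \<and> box K L (N V) {} \<subseteq> V"
    by metis
  \<comment> \<open>Neighbourhoods of the common point are sorted by the part in \<open>L\<close> of
    their chosen finite set of restricted coordinates.\<close>
  define Q where "Q G = {V \<in> B. {} \<in> V \<and> N V \<inter> L = G}" for G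
  have card: "|Q G| <o \<mu>" if G: "G \<in> Fpow L" for G
  proof -
    have G': "finite G" "G \<subseteq> L" using G by (auto simp: Fpow_def)
    \<comment> \<open>With a fresh coordinate \<open>l\<close>, points near \<open>{l}\<close> lie
      on the \<open>L\<close> side and can be made to miss \<open>G\<close>, so they meet all
      restrictions of members of \<open>Q G\<close>, whatever these demand in
      \<open>K\<close>.\<close>
    then obtain l where l: "l \<in> L" "l \<notin> G" using L by (metis finite_subset subsetI)
    have "openin (wedge K L) (box K L (insert l G) {l})" using G' l by (intro openin_box) auto
    moreover have "{l} \<in> box K L (insert l G) {l}" using l by (auto simp: box_def wedge_points_def)
    ultimately obtain W where W: "W \<in> B" "{l} \<in> W" "W \<subseteq> box K L (insert l G) {l}" using base(2) by blast
    have "Q G \<subseteq> {V \<in> B. W \<subseteq> V}"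
    proof
      fix V assume V: "V \<in> Q G"
      have "W \<subseteq> V"
      proof
        fix S assume "S \<in> W"
        then have S: "S \<in> wedge_points K L" "S \<inter> insert l G = {l}" using W(3) by (auto simp: box_def)
        then have "S \<subseteq> L" using l KL by (auto simp: wedge_points_def)
        moreover have "S \<inter> G = {}" using S(2) l by auto
        ultimately have "S \<in> box K L (N V) {}" using V S(1) by (auto simp: box_def Q_def)
        then show "S \<in> V" using N(2)[of V] V by (auto simp: Q_def)
      qed
      then show "V \<in> {V \<in> B. W \<subseteq> V}" using V by (auto simp: Q_def)
    qed
    then have "|Q G| \<le>o |{V \<in> B. W \<subseteq> V}|" by (rule card_of_mono1)
    then show ?thesis using op W(1) unfolding op_like_def using ordLeq_ordLess_trans by blast
  qed
  have "a \<in> (\<Union>G\<in>Fpow L. \<Union>V\<in>Q G. N V)" if a: "a \<in> K" for a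
  proof -
    have "openin (wedge K L) (box K L {a} {})" using a by (intro openin_box) auto
    moreover have "{} \<in> box K L {a} {}" by (auto simp: box_def wedge_points_def)
    ultimately obtain V where V: "V \<in> B" "{} \<in> V" "V \<subseteq> box K L {a} {}" using base(2) by blast
    have "a \<in> N V"
    proof (rule ccontr)
      assume "a \<notin> N V"
      then have "{a} \<in> box K L (N V) {}" using a by (auto simp: box_def wedge_points_def)
      then have "{a} \<in> box K L {a} {}" using N(2)[OF V(1,2)] V(3) by blast
      then show False by (simp add: box_def)
    qed
    moreover have "N V \<inter> L \<in> Fpow L" using N(1) by (auto simp: Fpow_def)
    moreover have "V \<in> Q (N V \<inter> L)" using V by (simp add: Q_def)
    ultimately show ?thesis by blast
  qed
  then show ?thesis using N(1) card by (intro exI[of _ Q] exI[of _ N] conjI ballI allI subsetI)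
qed

section \<open>Upper bounds for the Noetherian type of a wedge\<close>

lemma card_of_Fpow_infinite_ordLeq:
  assumes "infinite A"
  shows "|Fpow A| \<le>o |A|"
proof -
  have "|{S. S \<subseteq> A \<and> finite S \<and> card S = n}| \<le>o |A|" for n
  proof (induction n)
    case 0
    have "{S. S \<subseteq> A \<and> finite S \<and> card S = 0} = {{}}" by auto
    then show ?case using assms card_of_singl_ordLeq[of A "{}"] by auto
  next
    case (Suc n)
    let ?P = "{S. S \<subseteq> A \<and> finite S \<and> card S = n}"
    have "{S. S \<subseteq> A \<and> finite S \<and> card S = Suc n} \<subseteq> (\<lambda>(x, S). insert x S) ` (A \<times> ?P)"
    proof
      fix S assume "S \<in> {S. S \<subseteq> A \<and> finite S \<and> card S = Suc n}"
      then obtain x T where "S = insert x T" "x \<notin> T" "S \<subseteq> A" "finite S" "card T = n"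
        using card_Suc_eq[of S n] by auto
      then show "S \<in> (\<lambda>(x, S). insert x S) ` (A \<times> ?P)" by (intro image_eqI[of _ _ "(x, T)"]) auto
    qed
    moreover have "|A \<times> ?P| \<le>o |A|"
      using Suc assms by (intro card_of_Times_ordLeq_infinite_Field)
        (simp_all add: Field_card_of card_of_card_order_on card_of_mono1)
    ultimately show ?case by (meson card_of_image card_of_mono1 ordLeq_transitive)
  qed
  moreover have "|UNIV :: nat set| \<le>o |A|" using assms infinite_iff_card_of_nat by blast
  ultimately have "|\<Union>n. {S. S \<subseteq> A \<and> finite S \<and> card S = n}| \<le>o |A|"
    by (intro card_of_UNION_ordLeq_infinite[OF assms]) blast+
  moreover have "Fpow A = (\<Union>n. {S. S \<subseteq> A \<and> finite S \<and> card S = n})" by (auto simp: Fpow_def)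
  ultimately show ?thesis by simp
qed

lemma finite_UN_ordLess:
  assumes "finite J" "\<And>j. j \<in> J \<Longrightarrow> |A j| <o \<kappa>" "Card_order \<kappa>" "infinite (Field \<kappa>)"
  shows "|\<Union>j\<in>J. A j| <o \<kappa>"
  using assms(1,2)
proof (induction J rule: finite_induct)
  case empty
  then show ?case using finite_ordLess_Card_order[of "{}"] assms by simp
next
  case (insert j J)
  then have "|A j \<union> (\<Union>j\<in>J. A j)| <o \<kappa>"
    using assms by (intro card_of_Un_ordLess_infinite_Field) auto
  then show ?case by simp
qed

text \<open>A neighbourhood of the common point that restricts coordinates \<open>a \<in> K\<close> is required to restrict
  some \<open>l \<in> L\<close> with \<open>R a l\<close> as well, so few of them contain a given open subset of the smaller cube.\<close>

lemma wedge_op_like_base: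
  assumes \<kappa>: "Card_order \<kappa>" "infinite (Field \<kappa>)" and KL: "K \<inter> L = {}"
    and L: "infinite L" "|L| <o \<kappa>"
    and dom: "\<And>a. a \<in> K \<Longrightarrow> \<exists>l\<in>L. R a l" and small: "\<And>l. l \<in> L \<Longrightarrow> |{a \<in> K. R a l}| <o \<kappa>"
  shows "has_op_like_base (wedge K L) \<kappa>"
proof -
  \<comment> \<open>Boxes away from the common point restrict one side only: a nonempty
    \<open>P\<close> already forces the side, so the other side needs no restriction.\<close>
  define ok where "ok F P \<longleftrightarrow> finite F \<and> F \<subseteq> K \<union> L \<and> P \<subseteq> F \<and>
    (P \<noteq> {} \<and> (F \<subseteq> K \<or> F \<subseteq> L) \<or> P = {} \<and> (\<forall>a\<in>F \<inter> K. \<exists>l\<in>F \<inter> L. R a l))" for F P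
  define B where "B = {box K L F P | F P. ok F P}"
  have "is_base (wedge K L) B"
    unfolding is_base_iff
  proof (intro conjI ballI allI impI)
    fix V assume "V \<in> B"
    then show "openin (wedge K L) V" by (auto simp: B_def ok_def intro: openin_box)
  next
    fix U S assume U: "openin (wedge K L) U" "S \<in> U"
    have SW: "S \<in> wedge_points K L" using openin_subset[OF U(1)] U(2) by (auto simp: topspace_wedge)
    from wedge_nbhd[OF U] obtain F where F: "finite F" "F \<subseteq> K \<union> L" "box K L F (S \<inter> F) \<subseteq> U" .
    show "\<exists>V\<in>B. S \<in> V \<and> V \<subseteq> U"
    proof (cases "S = {}")
      case True
      obtain d where d: "\<And>a. a \<in> K \<Longrightarrow> d a \<in> L \<and> R a (d a)" using dom by metis
      define F' where "F' = F \<union> d ` (F \<inter> K)"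
      have "d ` (F \<inter> K) \<subseteq> L" using d by auto
      then have "ok F' {}"
        using F(1,2) d KL unfolding ok_def F'_def by fastforce
      moreover have "S \<in> box K L F' {}" using True SW by (simp add: box_def)
      moreover have "box K L F' {} \<subseteq> U" using F(3) True by (auto simp: box_def F'_def)
      ultimately show ?thesis unfolding B_def by blast
    next
      case False
      then obtain s where s: "s \<in> S" by blast
      obtain M where M: "S \<subseteq> M" "M = K \<or> M = L" using SW by (auto simp: wedge_points_def)
      have side: "T \<subseteq> M" if "T \<in> wedge_points K L" "s \<in> T" for T
        using that M s KL by (auto simp: wedge_points_def)
      define F' where "F' = insert s (F \<inter> M)"
      have "ok F' (S \<inter> F')" using F(1) M s unfolding ok_def F'_def by auto
      moreover have "S \<in> box K L F' (S \<inter> F')" using SW by (simp add: box_def)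
      moreover have "box K L F' (S \<inter> F') \<subseteq> U"
      proof
        fix T assume "T \<in> box K L F' (S \<inter> F')"
        then have T: "T \<in> wedge_points K L" "T \<inter> F' = S \<inter> F'" by (auto simp: box_def)
        then have "s \<in> T" using s by (auto simp: F'_def)
        then have "T \<subseteq> M" using side T(1) by blast
        then have "T \<inter> F = S \<inter> F" using T(2) M(1) by (auto simp: F'_def)
        then show "T \<in> U" using T(1) F(3) by (auto simp: box_def)
      qed
      ultimately show ?thesis unfolding B_def by blast
    qed
  qed
  moreover have "op_like B \<kappa>"
    unfolding op_like_def
  proof
    fix U assume "U \<in> B"
    then obtain F P where U: "U = box K L F P" and FP: "ok F P" by (auto simp: B_def)
    \<comment> \<open>Only these coordinates can be restricted by a superset of \<open>U\<close>; an
      \<open>a\<close> in \<open>K\<close> outside \<open>F\<close> enters only through some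
      \<open>l\<close> that \<open>U\<close> itself restricts.\<close>
    define M where "M = F \<union> L \<union> (\<Union>l\<in>F \<inter> L. {a \<in> K. R a l})"
    have finF: "finite F" using FP by (simp add: ok_def)
    have inM: "F' \<subseteq> M" if ok': "ok F' P'" and sub: "box K L F P \<subseteq> box K L F' P'" for F' P'
    proof
      fix a assume a: "a \<in> F'"
      show "a \<in> M"
      proof (rule ccontr)
        assume "a \<notin> M"
        then have aK: "a \<in> K" "a \<notin> F" "a \<notin> L" and aR: "\<And>l. l \<in> F \<inter> L \<Longrightarrow> \<not> R a l"
          using ok' a by (auto simp: ok_def M_def)
        have PF: "P \<subseteq> F" "F \<subseteq> K \<union> L" using FP by (auto simp: ok_def)
        have PW: "P \<in> wedge_points K L" using FP by (auto simp: ok_def wedge_points_def)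
        then have "P \<in> box K L F P" using PF by (auto simp: box_def)
        then have PP: "P \<inter> F' = P'" using sub by (auto simp: box_def)
        show False
        proof (cases "P \<subseteq> K")
          case True
          \<comment> \<open>\<open>U\<close> leaves \<open>a\<close> free, so adding
            \<open>a\<close> to \<open>P\<close> stays in \<open>U\<close> but violates the larger
            box.\<close>
          then have "insert a P \<in> box K L F P" using aK PF by (auto simp: box_def wedge_points_def)
          then have "insert a P \<inter> F' = P'" using sub by (auto simp: box_def)
          then show False using PP a aK(2) PF by auto
        next
          case False
          then have "P \<subseteq> L" using PW by (auto simp: wedge_points_def)
          have "P' = {}"
          proof (rule ccontr)
            assume "P' \<noteq> {}"
            then have "F' \<subseteq> K" using ok' a aK unfolding ok_def by auto
            then show False using \<open>P' \<noteq> {}\<close> PP \<open>P \<subseteq> L\<close> KL by auto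
          qed
          \<comment> \<open>On the side of \<open>L\<close> the coordinate \<open>a\<close> has no
            effect; its companion \<open>l\<close>, which \<open>U\<close> leaves free, takes its
            role.\<close>
          then obtain l where l: "l \<in> F' \<inter> L" "R a l" using ok' a aK unfolding ok_def by auto
          then have "l \<notin> F" using aR by blast
          then have "insert l P \<in> box K L F P" using l PF \<open>P \<subseteq> L\<close> by (auto simp: box_def wedge_points_def)
          then have "insert l P \<inter> F' = P'" using sub by (auto simp: box_def)
          then show False using l \<open>P' = {}\<close> by auto
        qed
      qed
    qed
    have "|M| <o \<kappa>"
      unfolding M_def using finF finite_ordLess_Card_order[OF _ \<kappa>] L(2) small \<kappa>
      by (intro card_of_Un_ordLess_infinite_Field finite_UN_ordLess) auto
    moreover have infM: "infinite M" using L(1) by (auto simp: M_def)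
    have "{V \<in> B. U \<subseteq> V} \<subseteq> (\<lambda>(F, P). box K L F P) ` (Fpow M \<times> Fpow M)"
    proof
      fix V assume "V \<in> {V \<in> B. U \<subseteq> V}"
      then obtain F' P' where V: "V = box K L F' P'" "ok F' P'" "U \<subseteq> V" by (auto simp: B_def)
      then have "F' \<subseteq> M" using inM U by blast
      then have "F' \<in> Fpow M" "P' \<in> Fpow M" using V(2) by (auto simp: ok_def Fpow_def intro: finite_subset)
      then show "V \<in> (\<lambda>(F, P). box K L F P) ` (Fpow M \<times> Fpow M)" using V(1) by auto
    qed
    then have "|{V \<in> B. U \<subseteq> V}| \<le>o |Fpow M \<times> Fpow M|"
      by (meson card_of_image card_of_mono1 ordLeq_transitive)
    moreover have "|Fpow M \<times> Fpow M| \<le>o |M|"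
      using card_of_Fpow_infinite_ordLeq[OF infM] infM
      by (intro card_of_Times_ordLeq_infinite_Field) (simp_all add: Field_card_of card_of_card_order_on)
    ultimately show "|{V \<in> B. U \<subseteq> V}| <o \<kappa>" by (meson ordLeq_ordLess_trans ordLeq_transitive)
  qed
  ultimately show ?thesis unfolding has_op_like_base_def by blast
qed

text \<open>The boxes form a base of size at most \<open>\<kappa>\<close>, which leaves no room for
  more than \<open>\<kappa>\<close> supersets.\<close>

lemma wedge_weight_base:
  assumes "Card_order \<kappa>" "infinite (K \<union> L)" "|K \<union> L| \<le>o \<kappa>"
  shows "has_op_like_base (wedge K L) (cardSuc \<kappa>)"
proof -
  define B where "B = (\<lambda>(F, P). box K L F (P \<inter> F)) ` (Fpow (K \<union> L) \<times> Fpow (K \<union> L))"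
  have "is_base (wedge K L) B"
    unfolding is_base_iff
  proof (intro conjI ballI allI impI)
    fix V assume "V \<in> B"
    then show "openin (wedge K L) V" by (auto simp: B_def Fpow_def intro: openin_box)
  next
    fix U S assume U: "openin (wedge K L) U" "S \<in> U"
    have SW: "S \<in> wedge_points K L" using openin_subset[OF U(1)] U(2) by (auto simp: topspace_wedge)
    from wedge_nbhd[OF U] obtain F where F: "finite F" "F \<subseteq> K \<union> L" "box K L F (S \<inter> F) \<subseteq> U" .
    have "box K L F (S \<inter> F) \<in> B" unfolding B_def
      using F by (intro image_eqI[of _ _ "(F, S \<inter> F)"]) (auto simp: Fpow_def)
    then show "\<exists>V\<in>B. S \<in> V \<and> V \<subseteq> U" using F(3) SW by (intro bexI) (auto simp: box_def)
  qed
  moreover have "|Fpow (K \<union> L) \<times> Fpow (K \<union> L)| \<le>o |K \<union> L|"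
    using card_of_Fpow_infinite_ordLeq[OF assms(2)] assms(2)
    by (intro card_of_Times_ordLeq_infinite_Field) (simp_all add: Field_card_of card_of_card_order_on)
  then have "|B| \<le>o \<kappa>" unfolding B_def by (meson assms(3) card_of_image ordLeq_transitive)
  then have "|{V \<in> B. U \<subseteq> V}| \<le>o \<kappa>" for U
    using card_of_mono1[of "{V \<in> B. U \<subseteq> V}" B] ordLeq_transitive by blast
  then have "op_like B (cardSuc \<kappa>)"
    unfolding op_like_def using cardSuc_ordLeq_ordLess[OF assms(1) card_of_Card_order] by blast
  ultimately show ?thesis unfolding has_op_like_base_def by blast
qed

section \<open>Singular cardinals and successors as Noetherian types\<close>

lemma uncountable_cofinality_UN_ordLess:
  fixes \<kappa> :: "'k rel"
  assumes \<kappa>: "uncountable_cofinality \<kappa>" and J: "countable J" and A: "\<And>j. j \<in> J \<Longrightarrow> |A j| <o \<kappa>"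
  shows "|\<Union>j\<in>J. A j| <o \<kappa>"
proof -
  have co: "Card_order \<kappa>" and inf: "infinite (Field \<kappa>)"
    and cof: "\<And>K. K \<subseteq> Field \<kappa> \<Longrightarrow> cofinal K \<kappa> \<Longrightarrow> \<not> countable K"
    using \<kappa> by (auto simp: uncountable_cofinality_def)
  have wo: "Well_order \<kappa>" using co by (simp add: card_order_on_def)
  have "\<exists>a\<in>Field \<kappa>. |A j| \<le>o |underS \<kappa> a|" if j: "j \<in> J" for j
  proof -
    obtain a where a: "a \<in> Field \<kappa>" "|A j| =o Restr \<kappa> (underS \<kappa> a)"
      using A[OF j] ordLess_iff_ordIso_Restr[OF wo card_of_Well_order] by blast
    have "|A j| =o |Field (Restr \<kappa> (underS \<kappa> a))|"
      using card_of_cong[OF a(2)] by (simp add: Field_card_of)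
    moreover have "|Field (Restr \<kappa> (underS \<kappa> a))| \<le>o |underS \<kappa> a|"
      by (rule card_of_mono1) (auto simp: Field_def)
    ultimately show ?thesis using a(1) ordIso_ordLeq_trans by blast
  qed
  then obtain a where a: "\<And>j. j \<in> J \<Longrightarrow> a j \<in> Field \<kappa> \<and> |A j| \<le>o |underS \<kappa> (a j)|" by metis
  \<comment> \<open>Each \<open>A j\<close> is no larger than a proper initial segment; countably
    many of these are bounded by one \<open>b\<close>, even if \<open>\<kappa>\<close> is
    singular.\<close>
  have "countable (a ` J)" "a ` J \<subseteq> Field \<kappa>" using J a by auto
  then have "\<not> cofinal (a ` J) \<kappa>" using cof by blast
  then obtain b where b: "b \<in> Field \<kappa>" "\<And>j. j \<in> J \<Longrightarrow> b = a j \<or> (b, a j) \<notin> \<kappa>"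
    unfolding cofinal_def by blast
  have le: "underS \<kappa> (a j) \<subseteq> underS \<kappa> b" if j: "j \<in> J" for j
  proof -
    have "a j = b \<or> a j \<in> underS \<kappa> b"
      using underS_cases[OF wo b(1), of "a j"] a[OF j] b(2)[OF j] by (auto simp: underS_def)
    then show ?thesis using underS_trans[OF wo, of _ "a j" b] by blast
  qed
  let ?S = "underS \<kappa> b <+> (UNIV :: nat set)"
  have "|\<Union>j\<in>J. A j| \<le>o |?S|"
  proof (rule card_of_UNION_ordLeq_infinite)
    show "|J| \<le>o |?S|"
      using J card_of_Plus2 ordLeq_transitive unfolding countable_card_of_nat by blast
    show "\<forall>j\<in>J. |A j| \<le>o |?S|"
      using a card_of_mono1[OF le] card_of_Plus1 ordLeq_transitive by meson
  qed simp
  moreover have "|?S| <o \<kappa>"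
  proof (rule card_of_Plus_ordLess_infinite_Field[OF inf co])
    show "|underS \<kappa> b| <o \<kappa>" using card_of_underS[OF co b(1)] .
    \<comment> \<open>The field is cofinal in itself, so \<open>\<kappa>\<close> is uncountable and
      the summand omega stays below it.\<close>
    have "cofinal (Field \<kappa>) \<kappa>" using infinite_Card_order_limit[OF co inf] by (auto simp: cofinal_def)
    then have "\<not> countable (Field \<kappa>)" using cof by blast
    then have "|UNIV :: nat set| <o |Field \<kappa>|"
      unfolding countable_card_of_nat
      using not_ordLeq_iff_ordLess[OF card_of_Well_order card_of_Well_order] by blast
    then show "|UNIV :: nat set| <o \<kappa>" using card_of_Field_ordIso[OF co] ordLess_ordIso_trans by blast
  qed
  ultimately show ?thesis using ordLeq_ordLess_trans by blast
qed

text \<open>Disjoint copies of index sets inside \<open>'a set\<close>, as singletons and as complements of singletons,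
  leaving the empty set free for the switch coordinate.\<close>

lemma wedge_coordinates:
  fixes A B :: "'a set"
  assumes "infinite A"
  shows "(\<lambda>a. {a}) ` A \<inter> (\<lambda>b. - {b}) ` B = {}" "{} \<notin> (\<lambda>a. {a}) ` A \<union> (\<lambda>b. - {b}) ` B"
    "|(\<lambda>a. {a}) ` A| =o |A|" "|(\<lambda>b. - {b}) ` B| =o |B|"
proof -
  have "infinite (UNIV :: 'a set)" using infinite_super[OF subset_UNIV assms] .
  \<comment> \<open>Singletons and the empty set are finite, complements of singletons are
    not.\<close>
  then have cofin: "finite S \<Longrightarrow> S \<noteq> - {b}" for S and b :: 'a
    by (metis finite.emptyI finite.insertI finite_compl)
  have "{a} \<noteq> - {b}" "{} \<noteq> - {b}" for a b :: 'a by (rule cofin, simp)+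
  then show "(\<lambda>a. {a}) ` A \<inter> (\<lambda>b. - {b}) ` B = {}" "{} \<notin> (\<lambda>a. {a}) ` A \<union> (\<lambda>b. - {b}) ` B"
    by blast+
  show "|(\<lambda>a. {a}) ` A| =o |A|" "|(\<lambda>b. - {b}) ` B| =o |B|"
    by (intro ordIso_symmetric[OF card_of_ordIsoI[OF inj_on_imp_bij_betw]]; simp add: inj_on_def)+
qed

text \<open>\<open>L\<close> is indexed by a cofinal set of fewer than \<open>\<kappa>\<close>
  elements, and each \<open>a\<close> is attached to the larger elements \<open>b\<close> of that
  set. Each \<open>b\<close> then serves only a proper initial segment, while a bound below
  \<open>\<kappa>\<close> on the superset families would leave no room for all of
  \<open>K\<close>.\<close>

lemma singular_card_is_Nt:
  fixes \<kappa> :: "'a rel"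
  assumes "singular_card \<kappa>"
  shows "\<exists>X :: 'a set set topology. dyadic_compactum TYPE('a set) X \<and> Nt_eq X \<kappa>"
proof -
  have co: "Card_order \<kappa>" and inf: "infinite (Field \<kappa>)" and nreg: "\<not> regularCard \<kappa>"
    using assms by (auto simp: singular_card_def)
  obtain K0 where K0: "K0 \<subseteq> Field \<kappa>" "cofinal K0 \<kappa>" "\<not> |K0| =o \<kappa>"
    using nreg unfolding regularCard_def by blast
  have Fiso: "|Field \<kappa>| =o \<kappa>" using card_of_Field_ordIso[OF co] .
  have "|K0| \<le>o \<kappa>" using card_of_mono1[OF K0(1)] Fiso ordLeq_ordIso_trans by blast
  then have K0less: "|K0| <o \<kappa>" using K0(3) ordLeq_iff_ordLess_or_ordIso by blast
  have cover: "\<exists>b\<in>K0. a \<in> underS \<kappa> b" if "a \<in> Field \<kappa>" for a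
    using K0(2) that by (auto simp: cofinal_def underS_def)
  have small: "|underS \<kappa> b| <o \<kappa>" if "b \<in> K0" for b using card_of_underS[OF co] K0(1) that by blast
  have infK0: "infinite K0"
  proof
    assume "finite K0"
    then have "|\<Union>b\<in>K0. underS \<kappa> b| <o \<kappa>" using small co inf by (rule finite_UN_ordLess)
    moreover have "|Field \<kappa>| \<le>o |\<Union>b\<in>K0. underS \<kappa> b|" using cover by (intro card_of_mono1) blast
    ultimately have "|Field \<kappa>| <o \<kappa>" using ordLeq_ordLess_trans by blast
    then show False using Fiso not_ordLess_ordIso by blast
  qed
  define K where "K = (\<lambda>a. {a}) ` Field \<kappa>"
  define L where "L = (\<lambda>b. - {b}) ` K0"
  have KL: "K \<inter> L = {}" "{} \<notin> K \<union> L" "|K| =o |Field \<kappa>|" "|L| =o |K0|"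
    unfolding K_def L_def by (rule wedge_coordinates[OF inf])+
  have Liso: "|L| =o |K0|" and Kiso: "|K| =o \<kappa>"
    using KL ordIso_transitive[OF _ Fiso] by blast+
  have Lless: "|L| <o \<kappa>" using Liso K0less ordIso_ordLess_trans by blast
  have infL: "infinite L"
    using infK0 by (auto simp: L_def finite_image_iff inj_on_def)
  define R where "R s t \<longleftrightarrow> (\<exists>a b. s = {a} \<and> t = - {b} \<and> b \<in> K0 \<and> a \<in> underS \<kappa> b)" for s t :: "'a set"
  have "has_op_like_base (wedge K L) \<kappa>"
  proof (rule wedge_op_like_base[OF co inf KL(1) infL Lless])
    show "\<exists>l\<in>L. R s l" if "s \<in> K" for s
      using that cover unfolding K_def L_def R_def by blast
    show "|{s \<in> K. R s l}| <o \<kappa>" if l: "l \<in> L" for l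
    proof -
      obtain b where b: "b \<in> K0" "l = - {b}" using l by (auto simp: L_def)
      have "{s \<in> K. R s l} \<subseteq> (\<lambda>a. {a}) ` underS \<kappa> b" using b by (auto simp: R_def)
      then have "|{s \<in> K. R s l}| \<le>o |underS \<kappa> b|" by (meson card_of_image card_of_mono1 ordLeq_transitive)
      then show ?thesis using small[OF b(1)] ordLeq_ordLess_trans by blast
    qed
  qed
  moreover have "\<not> has_op_like_base (wedge K L) (card_of A)"
    if A: "natLeq \<le>o card_of A" "card_of A <o \<kappa>" for A :: "'a set"
  proof
    assume "has_op_like_base (wedge K L) |A|"
    then obtain B where "is_base (wedge K L) B" "op_like B |A|" by (auto simp: has_op_like_base_def)
    from wedge_base_large[OF KL(1) infL this] obtain Q N where
      Q: "\<And>G. G \<in> Fpow L \<Longrightarrow> |Q G :: 'a set set set set| <o |A|" and N: "\<And>V. finite (N V)"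
      and KQ: "K \<subseteq> (\<Union>G\<in>Fpow L. \<Union>V\<in>Q G. N V)" by blast
    \<comment> \<open>Fewer than |A| finite sets for each of the |L| many \<open>G\<close> contain
      at most |A| + |L| elements in all, still below \<open>\<kappa>\<close>.\<close>
    let ?S = "A <+> L"
    have infS: "infinite ?S" using infL by (simp add: finite_Plus_iff)
    have "|\<Union>G\<in>Fpow L. \<Union>V\<in>Q G. N V| \<le>o |?S|"
    proof (rule card_of_UNION_ordLeq_infinite[OF infS])
      show "|Fpow L| \<le>o |?S|"
        using card_of_Fpow_infinite_ordLeq[OF infL] card_of_Plus2 ordLeq_transitive by blast
      show "\<forall>G\<in>Fpow L. |\<Union>V\<in>Q G. N V| \<le>o |?S|"
      proof
        fix G assume G: "G \<in> Fpow L"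
        show "|\<Union>V\<in>Q G. N V| \<le>o |?S|"
        proof (rule card_of_UNION_ordLeq_infinite[OF infS])
          show "|Q G| \<le>o |?S|"
            using ordLess_imp_ordLeq[OF Q[OF G]] card_of_Plus1 ordLeq_transitive by blast
          show "\<forall>V\<in>Q G. |N V| \<le>o |?S|"
            using finite_ordLess_Card_order[OF N card_of_Card_order, of ?S] infS
            by (simp add: Field_card_of ordLess_imp_ordLeq)
        qed
      qed
    qed
    then have "|K| \<le>o |?S|" using card_of_mono1[OF KQ] ordLeq_transitive by blast
    moreover have "|?S| <o \<kappa>"
      using A(2) Lless by (intro card_of_Plus_ordLess_infinite_Field[OF inf co])
    ultimately have "|K| <o \<kappa>" using ordLeq_ordLess_trans by blast
    then show False using Kiso not_ordLess_ordIso by blast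
  qed
  ultimately have "Nt_eq (wedge K L) \<kappa>"
    unfolding Nt_eq_def using co Card_order_infinite_iff[OF co] inf by blast
  then show ?thesis using dyadic_compactum_wedge[OF KL(2)] by blast
qed

text \<open>A countable \<open>L\<close> gives countably many classes \<open>Q G\<close>, each of
  size below |A| \<le> \<kappa>; by uncountable cofinality their finite coordinate sets cannot
  exhaust \<open>K\<close>. The upper bound comes from the weight alone.\<close>

lemma cardSuc_is_Nt:
  fixes \<kappa> :: "'c rel"
  assumes uc: "uncountable_cofinality \<kappa>"
  shows "\<exists>X :: 'c set set topology. dyadic_compactum TYPE('c set) X \<and> Nt_eq X (cardSuc \<kappa>)"
proof -
  have co: "Card_order \<kappa>" and inf: "infinite (Field \<kappa>)"
    using uc by (auto simp: uncountable_cofinality_def)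
  have Fiso: "|Field \<kappa>| =o \<kappa>" using card_of_Field_ordIso[OF co] .
  obtain g :: "nat \<Rightarrow> 'c" where g: "inj g" "range g \<subseteq> Field \<kappa>"
    using infinite_countable_subset[OF inf] by blast
  define K where "K = (\<lambda>a. {a}) ` Field \<kappa>"
  define L where "L = (\<lambda>b. - {b}) ` range g"
  have KL: "K \<inter> L = {}" "{} \<notin> K \<union> L" "|K| =o |Field \<kappa>|" "|L| =o |range g|"
    unfolding K_def L_def by (rule wedge_coordinates[OF inf])+
  have Kiso: "|K| =o \<kappa>" using KL(3) ordIso_transitive[OF _ Fiso] by blast
  have cL: "countable L" by (simp add: L_def)
  have infL: "infinite L"
    using range_inj_infinite[OF g(1)] by (auto simp: L_def finite_image_iff inj_on_def)
  have "|L| \<le>o |range g|" unfolding L_def by (rule card_of_image)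
  then have "|L| \<le>o \<kappa>"
    using card_of_mono1[OF g(2)] Fiso ordLeq_ordIso_trans ordLeq_transitive by blast
  then have "|K \<union> L| \<le>o \<kappa>"
    using ordIso_imp_ordLeq[OF Kiso] by (intro card_of_Un_ordLeq_infinite_Field[OF inf]) (auto simp: co)
  then have "has_op_like_base (wedge K L) (cardSuc \<kappa>)"
    using infL by (intro wedge_weight_base[OF co]) auto
  moreover have "\<not> has_op_like_base (wedge K L) (card_of A)"
    if A: "card_of A <o cardSuc \<kappa>" for A :: "'c set set"
  proof
    assume "has_op_like_base (wedge K L) |A|"
    then obtain B where "is_base (wedge K L) B" "op_like B |A|" by (auto simp: has_op_like_base_def)
    from wedge_base_large[OF KL(1) infL this] obtain Q N where
      Q: "\<And>G. G \<in> Fpow L \<Longrightarrow> |Q G :: 'c set set set set| <o |A|" and N: "\<And>V. finite (N V)"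
      and KQ: "K \<subseteq> (\<Union>G\<in>Fpow L. \<Union>V\<in>Q G. N V)" by blast
    have A\<kappa>: "|A| \<le>o \<kappa>" using A cardSuc_ordLeq_ordLess[OF co card_of_Card_order] by blast
    have "|\<Union>V\<in>Q G. N V| <o \<kappa>" if G: "G \<in> Fpow L" for G
    proof (cases "finite (Q G)")
      case True
      then show ?thesis using N by (intro finite_ordLess_Card_order[OF _ co inf]) auto
    next
      case False
      have "|\<Union>V\<in>Q G. N V| \<le>o |Q G|"
      proof (rule card_of_UNION_ordLeq_infinite[OF False])
        show "|Q G| \<le>o |Q G|" by (rule card_of_mono1) simp
        show "\<forall>V\<in>Q G. |N V| \<le>o |Q G|"
          using finite_ordLess_Card_order[OF N card_of_Card_order, of "Q G"] False
          by (simp add: Field_card_of ordLess_imp_ordLeq)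
      qed
      then show ?thesis using Q[OF G] A\<kappa> by (meson ordLeq_ordLess_trans ordLess_ordLeq_trans)
    qed
    then have "|\<Union>G\<in>Fpow L. \<Union>V\<in>Q G. N V| <o \<kappa>"
      by (intro uncountable_cofinality_UN_ordLess[OF uc countable_Fpow[OF cL]])
    then have "|K| <o \<kappa>" using card_of_mono1[OF KQ] ordLeq_ordLess_trans by blast
    then show False using Kiso not_ordLess_ordIso by blast
  qed
  moreover have "Card_order (cardSuc \<kappa>)" using cardSuc_Card_order[OF co] .
  moreover have "natLeq \<le>o cardSuc \<kappa>"
    using Card_order_infinite_iff[OF cardSuc_Card_order[OF co]] cardSuc_finite[OF co] inf by blast
  ultimately have "Nt_eq (wedge K L) (cardSuc \<kappa>)" unfolding Nt_eq_def by blast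
  then show ?thesis using dyadic_compactum_wedge[OF KL(2)] by blast
qed

text \<open>A one-point space, the image of the cube without coordinates, is enough: no infinite
  cardinal lies below omega, so minimality is vacuous.\<close>

lemma omega_is_Nt: "\<exists>X :: nat topology. dyadic_compactum TYPE(nat) X \<and> Nt_eq X natLeq"
proof (intro exI conjI)
  let ?X = "discrete_topology {0 :: nat}"
  have "continuous_map (cantor_cube ({} :: nat set)) ?X (\<lambda>_. 0)"
    "(\<lambda>_. 0) ` topspace (cantor_cube ({} :: nat set)) = topspace ?X"
    by (simp_all add: topspace_cantor_cube)
  then show "dyadic_compactum TYPE(nat) ?X"
    unfolding dyadic_compactum_def using Hausdorff_space_discrete_topology by blast
  have "is_base ?X {{0}}" unfolding is_base_iff by auto
  moreover have "finite {V \<in> {{0 :: nat}}. U \<subseteq> V}" for U by simp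
  then have "op_like {{0 :: nat}} natLeq"
    unfolding op_like_def using finite_iff_ordLess_natLeq by blast
  ultimately show "Nt_eq ?X natLeq"
    unfolding Nt_eq_def has_op_like_base_def
    using natLeq_Card_order ordLeq_refl not_ordLess_ordLeq by blast
qed

theorem theorem1p6:
  shows "(\<exists>X :: nat topology. dyadic_compactum TYPE(nat) X \<and> Nt_eq X natLeq)
    \<and> (\<forall>X :: 'b topology. dyadic_compactum TYPE('i) X \<longrightarrow> \<not> Nt_eq X (cardSuc natLeq))
    \<and> (\<forall>\<kappa> :: 'a rel. singular_card \<kappa> \<longrightarrow>
          (\<exists>X :: 'a set set topology. dyadic_compactum TYPE('a set) X \<and> Nt_eq X \<kappa>))
    \<and> (\<forall>\<kappa> :: 'c rel. uncountable_cofinality \<kappa> \<longrightarrow>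
          (\<exists>X :: 'c set set topology. dyadic_compactum TYPE('c set) X \<and> Nt_eq X (cardSuc \<kappa>)))"
  using omega_is_Nt dyadic_not_Nt_omega1 singular_card_is_Nt cardSuc_is_Nt by blast

end
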